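(* Assume $(\varphi_0,u_0,\mu_0)\in H_0^1\times H_0^1\times H$, $\eta_1\in H_0^1$, $\eta_2\in H$. Let $(\mathbf P_M,\mathbf Q_M,\mathbf U_M,\mathbf V_M)$ be the solution on $[0,T]$ of the central-difference semi-discretization $$\begin{cases}d\mathbf Q_M=(\mathbf A\mathbf P_M+\mathbf U_M\cdot\mathbf P_M)\,dt-C_1\boldsymbol\eta_1\,dB_0(t),\\ d\mathbf P_M=-(\mathbf A\mathbf Q_M+\mathbf U_M\cdot\mathbf Q_M)\,dt+C_1\boldsymbol\eta_1\,dB_1(t),\\ d\mathbf V_M=\tfrac12(\mathbf A\mathbf U_M-\mathbf U_M+\mathbf P_M\cdot\mathbf P_M+\mathbf Q_M\cdot\mathbf Q_M)\,dt+\tfrac12C_2\boldsymbol\eta_2\,dB_2(t),\\ d\mathbf U_M=2\mathbf V_M\,dt.\end{cases}$$ Then, with $\mathcal N(\mathbf P,\mathbf Q)=\|\mathbf P\|_h^2+\|\mathbf Q\|_h^2$, $$\mathbb{E}[\mathcal N(\mathbf P_M(t),\mathbf Q_M(t))]=\mathbb{E}[\mathcal N(\mathbf P_M(0),\mathbf Q_M(0))]+2C_1^2\|\boldsymbol\eta_1\|_h^2\,t.$$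
   Context: $H=L^2([a,b])$ and $H_0^1$ is the space of $H^1([a,b])$ functions vanishing at $a,b$. $C_1,C_2\in\mathbb{R}$, $T>0$; $B_0,B_1,B_2$ are independent standard real Wiener processes; $\eta_1,\eta_2$ are sufficiently smooth real-valued functions on $[a,b]$. $M$ is a positive integer, $h=(b-a)/M$, $x_i=a+ih$, and $\boldsymbol\eta_k=(\eta_k(x_1),\dots,\eta_k(x_{M-1}))^\top$ for $k=1,2$. $\mathbf A$ is the $(M-1)\times(M-1)$ tridiagonal matrix $h^{-2}\,\mathrm{tridiag}(1,-2,1)$. For vectors in $\mathbb{R}^{M-1}$, $\cdot$ denotes the componentwise product, $\langle f,g\rangle_h=h\sum_{i=1}^{M-1}\operatorname{Re}(f_i\bar g_i)$ and $\|f\|_h=\sqrt{\langle f,f\rangle_h}$. The unknowns are $\mathbb{R}^{M-1}$-valued processes; $\mathbf P_M(0),\mathbf Q_M(0),\mathbf U_M(0),\mathbf V_M(0)\in\mathbb{R}^{M-1}$ are the approximations at the grid points $x_1,\dots,x_{M-1}$ of $\operatorname{Re}\varphi_0,\operatorname{Im}\varphi_0,u_0,\tfrac12\mu_0$ respectively. The system approximates the stochastic Klein--Gordon--Schrödinger equation with initial data $\varphi_0$ (complex-valued), $u_0$, $\mu_0$ (real-valued, $u(0)=u_0$, $u_t(0)=\mu_0$) and homogeneous Dirichlet boundary conditions. *)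

theory Defs
  imports "HOL-Probability.Probability"
begin

section \<open>Function spaces on an interval\<close>

text \<open>Elements of \<open>L\<^sup>2\<close> are represented by actual functions, so that they can be evaluated
  at grid points.\<close>

definition L2_on :: "real \<Rightarrow> real \<Rightarrow> (real \<Rightarrow> 'b::euclidean_space) set" where
  "L2_on a b = {f \<in> borel_measurable (lebesgue_on {a..b}).
     integrable (lebesgue_on {a..b}) (\<lambda>x. (norm (f x))\<^sup>2)}"

definition bump_on :: "real \<Rightarrow> real \<Rightarrow> (real \<Rightarrow> real) set" where
  "bump_on a b = {\<psi>. (\<forall>n x. ((deriv ^^ n) \<psi>) differentiable (at x)) \<and>
     (\<exists>c d. a < c \<and> d < b \<and> (\<forall>x. x \<notin> {c..d} \<longrightarrow> \<psi> x = 0))}"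

definition weak_derivative_on ::
    "real \<Rightarrow> real \<Rightarrow> (real \<Rightarrow> 'b::euclidean_space) \<Rightarrow> (real \<Rightarrow> 'b) \<Rightarrow> bool" where
  "weak_derivative_on a b f g \<longleftrightarrow> (\<forall>\<psi>\<in>bump_on a b.
     (LINT x|lebesgue_on {a..b}. deriv \<psi> x *\<^sub>R f x) =
     - (LINT x|lebesgue_on {a..b}. \<psi> x *\<^sub>R g x))"

definition H1_on :: "real \<Rightarrow> real \<Rightarrow> (real \<Rightarrow> 'b::euclidean_space) set" where
  "H1_on a b = {f \<in> L2_on a b. \<exists>g\<in>L2_on a b. weak_derivative_on a b f g}"

text \<open>Boundary values of an \<open>H\<^sup>1\<close> function are those of its continuous representative.\<close>

definition H10_on :: "real \<Rightarrow> real \<Rightarrow> (real \<Rightarrow> 'b::euclidean_space) set" where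
  "H10_on a b = {f \<in> H1_on a b. continuous_on {a..b} f \<and> f a = 0 \<and> f b = 0}"

section \<open>The spatial grid\<close>

text \<open>A vector of length \<open>M - 1\<close> is a function on \<open>nat\<close> of which only the
  entries with index in \<open>{1..<M}\<close> matter.\<close>

definition mesh :: "real \<Rightarrow> real \<Rightarrow> nat \<Rightarrow> real" where
  "mesh a b M = (b - a) / real M"

definition grid_values :: "real \<Rightarrow> real \<Rightarrow> nat \<Rightarrow> (real \<Rightarrow> real) \<Rightarrow> nat \<Rightarrow> real" where
  "grid_values a b M f i = f (a + real i * mesh a b M)"

definition lap_matrix :: "real \<Rightarrow> nat \<Rightarrow> nat \<Rightarrow> real" where
  "lap_matrix h i j =
     (if i = j then - 2 else if i = Suc j \<or> j = Suc i then 1 else 0) / h\<^sup>2"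

definition mat_vec :: "nat \<Rightarrow> (nat \<Rightarrow> nat \<Rightarrow> real) \<Rightarrow> (nat \<Rightarrow> real) \<Rightarrow> nat \<Rightarrow> real" where
  "mat_vec M A v i = (\<Sum>j\<in>{1..<M}. A i j * v j)"

text \<open>For complex entries \<open>f i \<bullet> g i\<close> is \<open>Re (f i * cnj (g i))\<close>; for real ones it is
  the product.\<close>

definition inner_h :: "real \<Rightarrow> nat \<Rightarrow> (nat \<Rightarrow> 'b::real_inner) \<Rightarrow> (nat \<Rightarrow> 'b) \<Rightarrow> real" where
  "inner_h h M f g = h * (\<Sum>i\<in>{1..<M}. f i \<bullet> g i)"

definition norm_h :: "real \<Rightarrow> nat \<Rightarrow> (nat \<Rightarrow> 'b::real_inner) \<Rightarrow> real" where
  "norm_h h M f = sqrt (inner_h h M f f)"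

definition charge :: "real \<Rightarrow> nat \<Rightarrow> (nat \<Rightarrow> real) \<Rightarrow> (nat \<Rightarrow> real) \<Rightarrow> real" where
  "charge h M p q = (norm_h h M p)\<^sup>2 + (norm_h h M q)\<^sup>2"

section \<open>Wiener processes\<close>

definition wiener_process :: "'a measure \<Rightarrow> (real \<Rightarrow> 'a \<Rightarrow> real) \<Rightarrow> bool" where
  "wiener_process \<Omega> W \<longleftrightarrow>
     (\<forall>t\<ge>0. W t \<in> borel_measurable \<Omega>) \<and>
     (AE \<omega> in \<Omega>. W 0 \<omega> = 0) \<and>
     (AE \<omega> in \<Omega>. continuous_on {0..} (\<lambda>t. W t \<omega>)) \<and>
     (\<forall>s t. 0 \<le> s \<and> s < t \<longrightarrow>
        distributed \<Omega> lborel (\<lambda>\<omega>. W t \<omega> - W s \<omega>) (normal_density 0 (sqrt (t - s)))) \<and>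
     (\<forall>(n::nat) \<tau>. 0 \<le> \<tau> 0 \<and> mono \<tau> \<longrightarrow>
        prob_space.indep_vars \<Omega> (\<lambda>_. borel) (\<lambda>k \<omega>. W (\<tau> (Suc k)) \<omega> - W (\<tau> k) \<omega>) {..<n})"

text \<open>Independence as processes, i.e. of the sample paths as random elements of the product
  space over the time axis.\<close>

definition indep_processes ::
    "'a measure \<Rightarrow> 'i set \<Rightarrow> ('i \<Rightarrow> real \<Rightarrow> 'a \<Rightarrow> real) \<Rightarrow> bool" where
  "indep_processes \<Omega> I B \<longleftrightarrow>
     prob_space.indep_vars \<Omega> (\<lambda>_. PiM {0..} (\<lambda>_. borel))
       (\<lambda>i \<omega>. \<lambda>t\<in>{0..}. B i t \<omega>) I"

definition adapted :: "(real \<Rightarrow> 'a measure) \<Rightarrow> real set \<Rightarrow> (real \<Rightarrow> 'a \<Rightarrow> real) \<Rightarrow> bool" where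
  "adapted F J X \<longleftrightarrow> (\<forall>t\<in>J. X t \<in> borel_measurable (F t))"

text \<open>Independent standard Wiener processes relative to a filtration: the joint increment of
  the family after time \<open>s\<close> is independent of \<open>F s\<close>.  (Independence of each single increment
  from \<open>F s\<close> would not be enough.)\<close>

definition indep_wiener_processes ::
    "'a measure \<Rightarrow> (real \<Rightarrow> 'a measure) \<Rightarrow> 'i set \<Rightarrow> ('i \<Rightarrow> real \<Rightarrow> 'a \<Rightarrow> real) \<Rightarrow> bool" where
  "indep_wiener_processes \<Omega> F I B \<longleftrightarrow>
     (\<forall>i\<in>I. wiener_process \<Omega> (B i) \<and> adapted F {0..} (B i)) \<and>
     indep_processes \<Omega> I B \<and>
     (\<forall>s t. 0 \<le> s \<and> s \<le> t \<longrightarrow>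
        prob_space.indep_set \<Omega> (sets (F s))
          (sets (vimage_algebra (space \<Omega>) (\<lambda>\<omega>. \<lambda>i\<in>I. B i t \<omega> - B i s \<omega>)
             (PiM I (\<lambda>_. borel)))))"

section \<open>The semi-discrete system\<close>

text \<open>\<open>dX = f dt + g dW\<close> on \<open>[0, T]\<close> with a constant coefficient \<open>g\<close>, in integrated form; the
  It\^o integral of the constant \<open>g\<close> over \<open>[0, t]\<close> is \<open>g * (W t - W 0)\<close>.\<close>

definition solves_sde ::
    "'a measure \<Rightarrow> real \<Rightarrow> (real \<Rightarrow> 'a \<Rightarrow> real) \<Rightarrow> (real \<Rightarrow> 'a \<Rightarrow> real) \<Rightarrow> real \<Rightarrow>
     (real \<Rightarrow> 'a \<Rightarrow> real) \<Rightarrow> bool" where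
  "solves_sde \<Omega> T X f g W \<longleftrightarrow>
     (AE \<omega> in \<Omega>. \<forall>t\<in>{0..T}. (\<lambda>s. f s \<omega>) integrable_on {0..t} \<and>
        X t \<omega> = X 0 \<omega> + integral {0..t} (\<lambda>s. f s \<omega>) + g * (W t \<omega> - W 0 \<omega>))"

definition continuous_adapted ::
    "'a measure \<Rightarrow> (real \<Rightarrow> 'a measure) \<Rightarrow> real \<Rightarrow> (real \<Rightarrow> 'a \<Rightarrow> real) \<Rightarrow> bool" where
  "continuous_adapted \<Omega> F T X \<longleftrightarrow>
     adapted F {0..T} X \<and> (AE \<omega> in \<Omega>. continuous_on {0..T} (\<lambda>t. X t \<omega>))"

text \<open>The processes have the shape \<open>time \<Rightarrow> sample point \<Rightarrow> vector\<close>; \<open>\<eta>1\<close>, \<open>\<eta>2\<close> are the vectors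
  of grid values, and \<open>p0\<close>, \<open>q0\<close>, \<open>u0\<close>, \<open>v0\<close> the deterministic initial vectors.  The noise
  coefficient in the equation for \<open>U\<close> is \<open>0\<close>.\<close>

definition semidiscrete_KGS_solution ::
    "'a measure \<Rightarrow> (real \<Rightarrow> 'a measure) \<Rightarrow> real \<Rightarrow> real \<Rightarrow> nat \<Rightarrow> real \<Rightarrow> real \<Rightarrow>
     (nat \<Rightarrow> real) \<Rightarrow> (nat \<Rightarrow> real) \<Rightarrow> (nat \<Rightarrow> real \<Rightarrow> 'a \<Rightarrow> real) \<Rightarrow>
     (nat \<Rightarrow> real) \<Rightarrow> (nat \<Rightarrow> real) \<Rightarrow> (nat \<Rightarrow> real) \<Rightarrow> (nat \<Rightarrow> real) \<Rightarrow>
     (real \<Rightarrow> 'a \<Rightarrow> nat \<Rightarrow> real) \<Rightarrow> (real \<Rightarrow> 'a \<Rightarrow> nat \<Rightarrow> real) \<Rightarrow>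
     (real \<Rightarrow> 'a \<Rightarrow> nat \<Rightarrow> real) \<Rightarrow> (real \<Rightarrow> 'a \<Rightarrow> nat \<Rightarrow> real) \<Rightarrow> bool" where
  "semidiscrete_KGS_solution \<Omega> F T h M C1 C2 \<eta>1 \<eta>2 B p0 q0 u0 v0 P Q U V \<longleftrightarrow>
     (\<forall>i\<in>{1..<M}.
        continuous_adapted \<Omega> F T (\<lambda>t \<omega>. P t \<omega> i) \<and>
        continuous_adapted \<Omega> F T (\<lambda>t \<omega>. Q t \<omega> i) \<and>
        continuous_adapted \<Omega> F T (\<lambda>t \<omega>. U t \<omega> i) \<and>
        continuous_adapted \<Omega> F T (\<lambda>t \<omega>. V t \<omega> i) \<and>
        (AE \<omega> in \<Omega>. P 0 \<omega> i = p0 i \<and> Q 0 \<omega> i = q0 i \<and> U 0 \<omega> i = u0 i \<and> V 0 \<omega> i = v0 i) \<and>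
        solves_sde \<Omega> T (\<lambda>t \<omega>. Q t \<omega> i)
          (\<lambda>t \<omega>. mat_vec M (lap_matrix h) (P t \<omega>) i + U t \<omega> i * P t \<omega> i)
          (- (C1 * \<eta>1 i)) (B 0) \<and>
        solves_sde \<Omega> T (\<lambda>t \<omega>. P t \<omega> i)
          (\<lambda>t \<omega>. - (mat_vec M (lap_matrix h) (Q t \<omega>) i + U t \<omega> i * Q t \<omega> i))
          (C1 * \<eta>1 i) (B 1) \<and>
        solves_sde \<Omega> T (\<lambda>t \<omega>. V t \<omega> i)
          (\<lambda>t \<omega>. 1 / 2 * (mat_vec M (lap_matrix h) (U t \<omega>) i - U t \<omega> i
             + P t \<omega> i * P t \<omega> i + Q t \<omega> i * Q t \<omega> i))
          (1 / 2 * C2 * \<eta>2 i) (B 2) \<and>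
        solves_sde \<Omega> T (\<lambda>t \<omega>. U t \<omega> i) (\<lambda>t \<omega>. 2 * V t \<omega> i) 0 (B 2))"

end

theory Submission
  imports Defs
begin

text \<open>Write \<open>X = (P, Q)\<close> and \<open>N = |X|\<^sup>2\<close>. The drift of \<open>X\<close> is orthogonal to \<open>X\<close> because the
  discrete Laplacian is symmetric, so formally only the quadratic variation of the noise changes
  \<open>E(N)\<close>. To avoid stochastic integrals and stopping times, \<open>N\<close> is replaced by the bounded
  quantity \<open>\<phi>(N)\<close> with \<open>\<phi>(s) = s / (1 + \<epsilon> s)\<close>. On a uniform time grid, the increments of
  \<open>\<phi>(N)\<close> are split into the part caused by the noise increment, which is independent of the past
  and whose expectation is explicit up to an error of order \<open>\<epsilon>\<close>, and the part caused by the drift.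
  The drift parts add up to a quantity which tends to \<open>0\<close> pathwise as the grid is refined and which
  is bounded in \<open>L\<^sup>2\<close> (being a bounded variable minus the noise part), hence its expectation tends
  to \<open>0\<close>. This first gives \<open>E(\<phi>(N(t))) \<le> N(0) + \<kappa> t\<close> for all \<open>\<epsilon>\<close>, thus integrability of \<open>N(t)\<close>,
  which in turn controls the error term, and \<open>\<epsilon> \<rightarrow> 0\<close> yields equality.\<close>

section \<open>Damped squares\<close>

definition damp :: "real \<Rightarrow> real \<Rightarrow> real" where
  "damp \<epsilon> s = s / (1 + \<epsilon> * s)"

text \<open>The last bound comes from \<open>s - damp \<epsilon> s = \<epsilon> * s^2 / (1 +
  \<epsilon> * s)\<close>: the loss caused by damping vanishes with \<epsilon>. It will be applied
  to the deterministic initial charge.\<close>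

lemma damp_bounds:
  assumes "\<epsilon> > 0" "s \<ge> 0"
  shows "0 \<le> damp \<epsilon> s" "damp \<epsilon> s \<le> s" "damp \<epsilon> s \<le> 1 / \<epsilon>" "s - \<epsilon> * s\<^sup>2 \<le> damp \<epsilon> s"
proof -
  have pos: "1 + \<epsilon> * s > 0"
    using assms by (simp add: add_pos_nonneg)
  show "0 \<le> damp \<epsilon> s" "damp \<epsilon> s \<le> 1 / \<epsilon>"
    using assms pos by (auto simp: damp_def field_simps)
  have "0 \<le> \<epsilon> * s * s" "0 \<le> \<epsilon> * (\<epsilon> * (s * (s * s)))"
    using assms by simp_all
  then show "damp \<epsilon> s \<le> s" "s - \<epsilon> * s\<^sup>2 \<le> damp \<epsilon> s"
    using pos by (auto simp: damp_def field_simps power2_eq_square)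
qed

text \<open>Together with \<open>damp_tendsto\<close> this makes \<epsilon> -> 0 a monotone limit,
  so that monotone convergence can give integrability of the undamped charge.\<close>

lemma damp_antimono:
  assumes "0 \<le> \<epsilon>" "\<epsilon> \<le> \<delta>" "s \<ge> 0"
  shows "damp \<delta> s \<le> damp \<epsilon> s"
proof -
  have "\<epsilon> * s \<le> \<delta> * s" "0 \<le> \<epsilon> * s"
    using assms by (auto intro: mult_right_mono)
  then show ?thesis
    unfolding damp_def using assms by (intro divide_left_mono mult_pos_pos) linarith+
qed

text \<open>A first-order Taylor formula with exact remainder:
  \<open>1 / (1 + \<epsilon> * s)^2\<close> is the derivative of \<open>damp \<epsilon>\<close> at
  \<open>s\<close>, and the remainder has a sign by concavity.\<close>

lemma damp_diff:
  assumes "\<epsilon> > 0" "s \<ge> 0" "s' \<ge> 0"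
  shows "damp \<epsilon> s' - damp \<epsilon> s = (s' - s) / (1 + \<epsilon> * s)\<^sup>2
    - \<epsilon> * (s' - s)\<^sup>2 / ((1 + \<epsilon> * s)\<^sup>2 * (1 + \<epsilon> * s'))"
proof -
  have pos: "1 + \<epsilon> * s > 0" "1 + \<epsilon> * s' > 0"
    using assms by (simp_all add: add_pos_nonneg)
  have "damp \<epsilon> s' - damp \<epsilon> s = (s' - s) / ((1 + \<epsilon> * s) * (1 + \<epsilon> * s'))"
    using pos by (simp add: damp_def divide_simps) (simp add: algebra_simps)
  moreover have "(s' - s) / ((1 + \<epsilon> * s) * (1 + \<epsilon> * s'))
    = ((s' - s) * (1 + \<epsilon> * s') - \<epsilon> * (s' - s)\<^sup>2) / ((1 + \<epsilon> * s)\<^sup>2 * (1 + \<epsilon> * s'))"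
  proof -
    have "(s' - s) * (1 + \<epsilon> * s') - \<epsilon> * (s' - s)\<^sup>2 = (s' - s) * (1 + \<epsilon> * s)"
      by (simp add: power2_eq_square algebra_simps)
    then show ?thesis
      using pos by (simp add: power2_eq_square)
  qed
  ultimately show ?thesis
    using pos by (simp add: diff_divide_distrib)
qed

text \<open>The difference quotient is
  \<open>1 / ((1 + \<epsilon> * s) * (1 + \<epsilon> * s'))\<close>. Errors in the squared norm thus
  carry over to the damped squared norm, uniformly in \<epsilon>.\<close>

lemma damp_lipschitz:
  assumes "\<epsilon> > 0" "s \<ge> 0" "s' \<ge> 0"
  shows "\<bar>damp \<epsilon> s' - damp \<epsilon> s\<bar> \<le> \<bar>s' - s\<bar>"
proof -
  have pos: "1 + \<epsilon> * s \<ge> 1" "1 + \<epsilon> * s' \<ge> 1"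
    using assms by simp_all
  then have "damp \<epsilon> s' - damp \<epsilon> s = (s' - s) / ((1 + \<epsilon> * s) * (1 + \<epsilon> * s'))"
    by (simp add: damp_def divide_simps) (simp add: algebra_simps)
  moreover have "1 \<le> (1 + \<epsilon> * s) * (1 + \<epsilon> * s')"
    using mult_mono[OF pos] pos by simp
  moreover have "\<bar>s' - s\<bar> / c \<le> \<bar>s' - s\<bar>" if "1 \<le> c" for c
    using mult_left_mono[OF that, of "\<bar>s' - s\<bar>"] that by (simp add: divide_le_eq)
  ultimately show ?thesis
    by (simp add: abs_divide)
qed

lemma damp_measurable [measurable]: "damp \<epsilon> \<in> borel_measurable borel"
  unfolding damp_def[abs_def] by measurable

lemma damp_tendsto:
  assumes "s \<ge> 0"
  shows "(\<lambda>n. damp (1 / real (Suc n)) s) \<longlonglongrightarrow> s"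
proof -
  have "(\<lambda>n. s / (1 + 1 / real (Suc n) * s)) \<longlonglongrightarrow> s / (1 + 0 * s)"
    by (intro tendsto_intros lim_inverse_n'[THEN LIMSEQ_Suc]) auto
  then show ?thesis by (simp add: damp_def)
qed

abbreviation sqsum :: "'j set \<Rightarrow> ('j \<Rightarrow> real) \<Rightarrow> real" where
  "sqsum J x \<equiv> \<Sum>j\<in>J. (x j)\<^sup>2"

text \<open>The Taylor remainder of \<open>damp_diff\<close> between the squared norms before and
  after the displacement \<open>w\<close>.\<close>

definition damp_rem :: "real \<Rightarrow> 'j set \<Rightarrow> ('j \<Rightarrow> real) \<Rightarrow> ('j \<Rightarrow> real) \<Rightarrow> real" where
  "damp_rem \<epsilon> J x w = (let s = sqsum J x; s' = sqsum J (\<lambda>j. x j + w j) in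
     \<epsilon> * (s' - s)\<^sup>2 / ((1 + \<epsilon> * s)\<^sup>2 * (1 + \<epsilon> * s')))"

text \<open>Expanding the square of \<open>x + w\<close> in \<open>damp_diff\<close> separates a
  term linear in \<open>w\<close>, which will have mean zero, a quadratic term, which plays the role
  of the Ito correction, and the remainder.\<close>

lemma damp_increment:
  assumes "\<epsilon> > 0"
  shows "damp \<epsilon> (sqsum J (\<lambda>j. x j + w j)) - damp \<epsilon> (sqsum J x) =
    2 * (\<Sum>j\<in>J. x j / (1 + \<epsilon> * sqsum J x)\<^sup>2 * w j)
    + sqsum J w / (1 + \<epsilon> * sqsum J x)\<^sup>2 - damp_rem \<epsilon> J x w"
proof -
  have "sqsum J (\<lambda>j. x j + w j) - sqsum J x = 2 * (\<Sum>j\<in>J. x j * w j) + sqsum J w"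
    by (simp add: sum_distrib_left sum.distrib power2_sum algebra_simps)
  then show ?thesis
    using damp_diff[OF assms, of "sqsum J x" "sqsum J (\<lambda>j. x j + w j)"]
    by (simp add: damp_rem_def Let_def sum_nonneg add_divide_distrib sum_divide_distrib
        sum_distrib_left)
qed

text \<open>Since \<open>s' - s\<close> is the inner product of \<open>w\<close> and
  \<open>2 x + w\<close>, Cauchy-Schwarz gives \<open>(s' - s)^2 \<le> 2 * W * (s + s')\<close>.
  Keeping the denominator absorbs \<open>\<epsilon> * (s + s')\<close> and yields a bound free of
  \<open>x\<close>, used for second moments uniform over grids. Dropping it keeps the factor
  \<epsilon> at the price of \<open>sqsum J x\<close>, as the limit \<epsilon> -> 0
  requires.\<close>

lemma damp_rem_bounds:
  assumes "\<epsilon> > 0"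
  shows "0 \<le> damp_rem \<epsilon> J x w" "damp_rem \<epsilon> J x w \<le> 4 * sqsum J w"
    "damp_rem \<epsilon> J x w \<le> 2 * \<epsilon> * sqsum J w * (3 * sqsum J x + 2 * sqsum J w)"
proof -
  define s s' W where "s = sqsum J x" and "s' = sqsum J (\<lambda>j. x j + w j)" and "W = sqsum J w"
  have nonneg: "s \<ge> 0" "s' \<ge> 0" "W \<ge> 0"
    by (simp_all add: s_def s'_def W_def sum_nonneg)
  have ge1: "1 + \<epsilon> * s \<ge> 1" "1 + \<epsilon> * s' \<ge> 1"
    using nonneg assms by simp_all
  have rem: "damp_rem \<epsilon> J x w = \<epsilon> * (s' - s)\<^sup>2 / ((1 + \<epsilon> * s)\<^sup>2 * (1 + \<epsilon> * s'))"
    by (simp add: damp_rem_def s_def s'_def Let_def)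
  show "0 \<le> damp_rem \<epsilon> J x w"
    using ge1 assms by (simp add: rem)
  have two: "(a + b)\<^sup>2 \<le> 2 * a\<^sup>2 + 2 * b\<^sup>2" for a b :: real
    using zero_le_power2[of "a - b"] by (simp add: power2_eq_square algebra_simps)
  have "s' - s = (\<Sum>j\<in>J. w j * (x j + (x j + w j)))"
    by (simp add: s_def s'_def sum_subtractf[symmetric] power2_eq_square algebra_simps)
  then have "(s' - s)\<^sup>2 \<le> W * (\<Sum>j\<in>J. (x j + (x j + w j))\<^sup>2)"
    using Cauchy_Schwarz_ineq_sum by (simp add: W_def)
  also have "(\<Sum>j\<in>J. (x j + (x j + w j))\<^sup>2) \<le> (\<Sum>j\<in>J. 2 * (x j)\<^sup>2 + 2 * (x j + w j)\<^sup>2)"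
    by (intro sum_mono two)
  also have "\<dots> = 2 * (s + s')"
    by (simp add: s_def s'_def sum.distrib sum_distrib_left)
  finally have sq: "(s' - s)\<^sup>2 \<le> W * (2 * (s + s'))"
    using nonneg by (simp add: mult_left_mono)
  have "s' \<le> (\<Sum>j\<in>J. 2 * (x j)\<^sup>2 + 2 * (w j)\<^sup>2)"
    unfolding s'_def by (intro sum_mono two)
  then have s': "s' \<le> 2 * s + 2 * W"
    by (simp add: s_def W_def sum.distrib sum_distrib_left)
  have sqe: "\<epsilon> * (s' - s)\<^sup>2 \<le> \<epsilon> * (W * (2 * (s + s')))"
    using sq assms by simp
  let ?d = "(1 + \<epsilon> * s)\<^sup>2 * (1 + \<epsilon> * s')"
  have d: "(1 + \<epsilon> * s) * (1 + \<epsilon> * s') \<le> ?d"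
  proof -
    have "(1 + \<epsilon> * s) * 1 \<le> (1 + \<epsilon> * s) * (1 + \<epsilon> * s)"
      using ge1 by (intro mult_left_mono) auto
    then show ?thesis
      using ge1 by (intro mult_right_mono) (auto simp: power2_eq_square)
  qed
  have dd: "1 \<le> (1 + \<epsilon> * s) * (1 + \<epsilon> * s')"
    using mult_mono[OF ge1] ge1 by simp
  have "damp_rem \<epsilon> J x w \<le> \<epsilon> * (W * (2 * (s + s'))) / ?d"
    unfolding rem using sqe ge1 by (intro divide_right_mono) auto
  also have "\<dots> \<le> 4 * W"
  proof -
    \<comment> \<open>Both \<open>\<epsilon> * s\<close> and \<open>\<epsilon> * s'\<close> are
      below the product of the two factors, each of which is at least 1.\<close>
    have "\<epsilon> * (s + s') \<le> 2 * ((1 + \<epsilon> * s) * (1 + \<epsilon> * s'))"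
      using nonneg assms by (simp add: algebra_simps)
    also have "\<dots> \<le> 2 * ?d" using d by simp
    finally have "(2 * W) * (\<epsilon> * (s + s')) \<le> (2 * W) * (2 * ?d)"
      using nonneg by (intro mult_left_mono) auto
    then show ?thesis
      using dd d by (simp add: divide_le_eq algebra_simps)
  qed
  finally show "damp_rem \<epsilon> J x w \<le> 4 * sqsum J w"
    by (simp add: W_def)
  have "damp_rem \<epsilon> J x w \<le> \<epsilon> * (s' - s)\<^sup>2"
    unfolding rem using dd d assms mult_left_mono[of 1 ?d "\<epsilon> * (s' - s)\<^sup>2"]
    by (simp add: divide_le_eq)
  also have "\<dots> \<le> \<epsilon> * (W * (2 * (s + s')))" by (rule sqe)
  also have "\<dots> \<le> \<epsilon> * (W * (2 * (s + (2 * s + 2 * W))))"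
    using s' nonneg assms by (intro mult_left_mono) auto
  finally show "damp_rem \<epsilon> J x w \<le> 2 * \<epsilon> * sqsum J w * (3 * sqsum J x + 2 * sqsum J w)"
    by (simp add: W_def s_def algebra_simps)
qed

text \<open>The vector is half the gradient of the damped squared norm. Its squared length is
  \<open>s / (1 + \<epsilon> * s)^4\<close>, and a single factor of the denominator already bounds
  this by \<open>1 / \<epsilon>\<close>. Damping thus bounds the coefficients of the linear noise
  term.\<close>

lemma damp_gradient_bound:
  assumes "\<epsilon> > 0"
  shows "sqsum J (\<lambda>j. x j / (1 + \<epsilon> * sqsum J x)\<^sup>2) \<le> 1 / \<epsilon>"
proof -
  define s where "s = sqsum J x"
  have s: "s \<ge> 0" by (simp add: s_def sum_nonneg)
  have ge1: "1 + \<epsilon> * s \<ge> 1" using s assms by simp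
  have "sqsum J (\<lambda>j. x j / (1 + \<epsilon> * s)\<^sup>2) = s / (1 + \<epsilon> * s) ^ 4"
    by (simp add: power_divide sum_divide_distrib[symmetric] s_def flip: power_mult)
  also have "\<dots> \<le> s / (1 + \<epsilon> * s)"
    using s ge1 self_le_power[OF ge1, of 4] by (intro divide_left_mono) auto
  also have "\<dots> \<le> 1 / \<epsilon>"
    using damp_bounds(3)[OF assms s] by (simp add: damp_def)
  finally show ?thesis by (simp add: s_def)
qed

text \<open>The left side is the tangent at 0 of a convex function of \<open>y\<close>.\<close>

lemma inverse_square_ge:
  fixes y :: real
  assumes "y \<ge> 0"
  shows "1 - 2 * y \<le> 1 / (1 + y)\<^sup>2"
proof -
  have "(1 - 2 * y) * (1 + y)\<^sup>2 = 1 - 3 * (y * y) - 2 * (y * y * y)"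
    by (simp add: power2_eq_square algebra_simps)
  also have "\<dots> \<le> 1"
    using assms mult_nonneg_nonneg[of y y] mult_nonneg_nonneg[of "y * y" y] by linarith
  finally show ?thesis using assms by (simp add: pos_le_divide_eq)
qed

section \<open>Orthogonal drift along a path\<close>

text \<open>The drift has second-order effect on the squared norm because it is orthogonal to the
  solution at every instant.\<close>

lemma orthogonal_drift_one_step:
  fixes x f w :: "'j \<Rightarrow> real \<Rightarrow> real"
  assumes J: "finite J" and T: "0 \<le> T"
    and x: "\<And>j. j \<in> J \<Longrightarrow> continuous_on {0..T} (x j)"
    and f: "\<And>j. j \<in> J \<Longrightarrow> continuous_on {0..T} (f j)"
    and orth: "\<And>t. t \<in> {0..T} \<Longrightarrow> (\<Sum>j\<in>J. x j t * f j t) = 0"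
    and eq: "\<And>j t. j \<in> J \<Longrightarrow> t \<in> {0..T} \<Longrightarrow> x j t = x j 0 + integral {0..t} (f j) + w j t"
    and e: "e > 0"
  shows "\<exists>\<delta>>0. \<forall>s s'. 0 \<le> s \<longrightarrow> s \<le> s' \<longrightarrow> s' \<le> T \<longrightarrow> s' - s < \<delta> \<longrightarrow>
    \<bar>sqsum J (\<lambda>j. x j s') - sqsum J (\<lambda>j. x j s + (w j s' - w j s))\<bar> \<le> e * (s' - s)"
proof -
  have "compact ((\<lambda>t. \<Sum>j\<in>J. \<bar>f j t\<bar>) ` {0..T})"
    by (intro compact_continuous_image continuous_intros f) auto
  then obtain L0 where L0: "\<forall>y\<in>(\<lambda>t. \<Sum>j\<in>J. \<bar>f j t\<bar>) ` {0..T}. norm y \<le> L0"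
    using compact_imp_bounded bounded_iff by metis
  \<comment> \<open>The lower bound 1 keeps the divisions by \<open>L\<close> legitimate even for
    zero drift.\<close>
  define L where "L = max 1 L0"
  have L: "L \<ge> 1" by (simp add: L_def)
  have fL: "\<bar>f j t\<bar> \<le> L" if "j \<in> J" "t \<in> {0..T}" for j t
  proof -
    have "\<bar>f j t\<bar> \<le> (\<Sum>j\<in>J. \<bar>f j t\<bar>)"
      using that J by (intro member_le_sum) auto
    also have "\<dots> \<le> L0" using L0 that by fastforce
    finally show ?thesis by (simp add: L_def)
  qed
  \<comment> \<open>Adding 1 to the cardinality keeps \<open>c\<close> positive for empty
    \<open>J\<close>.\<close>
  define c where "c = real (card J) + 1"
  have c: "c > 0" "real (card J) \<le> c" by (simp_all add: c_def)
  \<comment> \<open>Chosen so that \<open>2 * c * e' * L = e / 2\<close>; likewise the entry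
    \<open>e / (2 * c * L^2)\<close> in \<delta> makes \<open>c * L^2 * \<delta>\<close> at most
    \<open>e / 2\<close>. The two error terms then add up to \<open>e\<close> per unit of
    time.\<close>
  define e' where "e' = e / (4 * c * L)"
  have e': "e' > 0" using e c L by (simp add: e'_def)
  have "\<exists>d>0. \<forall>u\<in>{0..T}. \<forall>v\<in>{0..T}. \<bar>v - u\<bar> < d \<longrightarrow> \<bar>x j v - x j u\<bar> < e'" if "j \<in> J" for j
    using compact_uniformly_continuous[OF x[OF that] compact_Icc] e'
    unfolding uniformly_continuous_on_def dist_real_def by blast
  then obtain d where d: "\<And>j. j \<in> J \<Longrightarrow> d j > 0"
    "\<And>j u v. j \<in> J \<Longrightarrow> u \<in> {0..T} \<Longrightarrow> v \<in> {0..T} \<Longrightarrow> \<bar>v - u\<bar> < d j \<Longrightarrow> \<bar>x j v - x j u\<bar> < e'"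
    by metis
  define \<delta> where "\<delta> = Min (insert (e / (2 * c * L\<^sup>2)) (d ` J))"
  have \<delta>: "\<delta> > 0" "\<delta> \<le> e / (2 * c * L\<^sup>2)" "\<And>j. j \<in> J \<Longrightarrow> \<delta> \<le> d j"
    using J d e c L by (auto simp: \<delta>_def)
  show ?thesis
  proof (intro exI[of _ \<delta>] conjI allI impI)
    fix s s' assume s: "0 \<le> s" "s \<le> s'" "s' \<le> T" "s' - s < \<delta>"
    define y where "y j = integral {s..s'} (f j)" for j
    have f': "continuous_on {s..s'} (f j)" if "j \<in> J" for j
      using f[OF that] s by (auto intro: continuous_on_subset)
    have xw: "x j s + (w j s' - w j s) = x j s' - y j" if "j \<in> J" for j
    proof -
      have "f j integrable_on {0..s'}"
        using s by (intro integrable_continuous_interval continuous_on_subset[OF f[OF that]]) auto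
      then have "integral {0..s} (f j) + y j = integral {0..s'} (f j)"
        unfolding y_def using s by (intro Henstock_Kurzweil_Integration.integral_combine) auto
      then show ?thesis
        using eq[OF that, of s] eq[OF that, of s'] s by simp
    qed
    have y: "\<bar>y j\<bar> \<le> L * (s' - s)" if "j \<in> J" for j
      unfolding y_def real_norm_def[symmetric]
      using s f'[OF that] fL[OF that] by (intro integral_bound) auto
    have y2: "sqsum J y \<le> c * L\<^sup>2 * (s' - s)\<^sup>2"
    proof -
      have "sqsum J y \<le> (\<Sum>j\<in>J. (L * (s' - s))\<^sup>2)"
        using y by (intro sum_mono power2_le_iff_abs_le[THEN iffD2]) (use s L in auto)
      also have "\<dots> = card J * (L\<^sup>2 * (s' - s)\<^sup>2)"
        by (simp add: power_mult_distrib)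
      also have "\<dots> \<le> c * (L\<^sup>2 * (s' - s)\<^sup>2)"
        using c by (intro mult_right_mono) auto
      finally show ?thesis by simp
    qed
    have xy: "\<bar>\<Sum>j\<in>J. x j s' * y j\<bar> \<le> c * e' * L * (s' - s)"
    proof -
      have "(\<Sum>j\<in>J. x j s' * y j) = (\<Sum>j\<in>J. integral {s..s'} (\<lambda>u. x j s' * f j u))"
        by (simp add: y_def)
      also have "\<dots> = integral {s..s'} (\<lambda>u. \<Sum>j\<in>J. x j s' * f j u)"
        by (intro integral_sum[symmetric] integrable_continuous_interval continuous_intros f' J)
      \<comment> \<open>Orthogonality at time \<open>u\<close> allows subtracting
        \<open>x j u\<close>, which replaces the value at \<open>s'\<close> by an increment that is
        small by uniform continuity.\<close>
      also have "\<dots> = integral {s..s'} (\<lambda>u. \<Sum>j\<in>J. (x j s' - x j u) * f j u)"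
        using s orth by (intro integral_cong) (auto simp: left_diff_distrib sum_subtractf)
      also have "norm \<dots> \<le> (c * e' * L) * (s' - s)"
      proof (intro integral_bound)
        show "continuous_on {s..s'} (\<lambda>u. \<Sum>j\<in>J. (x j s' - x j u) * f j u)"
          using s by (intro continuous_intros f' continuous_on_subset[OF x]) auto
        fix u assume u: "u \<in> {s..s'}"
        have "norm (\<Sum>j\<in>J. (x j s' - x j u) * f j u) \<le> (\<Sum>j\<in>J. e' * L)"
        proof (intro sum_norm_le)
          fix j assume j: "j \<in> J"
          have "\<bar>x j s' - x j u\<bar> < e'"
            using u s \<delta>(3)[OF j] by (intro d(2)[OF j]) auto
          then show "norm ((x j s' - x j u) * f j u) \<le> e' * L"
            using fL[OF j, of u] u s e' unfolding real_norm_def abs_mult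
            by (intro mult_mono) auto
        qed
        also have "\<dots> = card J * (e' * L)" by simp
        also have "\<dots> \<le> c * (e' * L)"
          using c e' L by (intro mult_right_mono) auto
        finally show "norm (\<Sum>j\<in>J. (x j s' - x j u) * f j u) \<le> c * e' * L" by simp
      qed (use s in auto)
      finally show ?thesis by simp
    qed
    have "sqsum J (\<lambda>j. x j s') - sqsum J (\<lambda>j. x j s + (w j s' - w j s))
        = (\<Sum>j\<in>J. 2 * (x j s' * y j) - (y j)\<^sup>2)"
      unfolding sum_subtractf[symmetric]
      by (intro sum.cong refl, subst xw) (simp_all add: power2_eq_square algebra_simps)
    also have "\<dots> = 2 * (\<Sum>j\<in>J. x j s' * y j) - sqsum J y"
      by (simp add: sum_subtractf sum_distrib_left)
    also have "\<bar>\<dots>\<bar> \<le> 2 * (c * e' * L * (s' - s)) + c * L\<^sup>2 * (s' - s)\<^sup>2"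
      using xy y2 sum_nonneg[of J "\<lambda>j. (y j)\<^sup>2"] by (simp add: abs_le_iff)
    also have "\<dots> \<le> e / 2 * (s' - s) + e / 2 * (s' - s)"
    proof (intro add_mono)
      show "2 * (c * e' * L * (s' - s)) \<le> e / 2 * (s' - s)"
        using c L by (simp add: e'_def)
      have "c * L\<^sup>2 * (s' - s) \<le> e / 2"
        using s \<delta>(2) mult_left_mono[of "s' - s" "e / (2 * c * L\<^sup>2)" "c * L\<^sup>2"] c L by simp
      then have "c * L\<^sup>2 * (s' - s) * (s' - s) \<le> e / 2 * (s' - s)"
        using s by (intro mult_right_mono) auto
      then show "c * L\<^sup>2 * (s' - s)\<^sup>2 \<le> e / 2 * (s' - s)"
        by (simp add: power2_eq_square mult.assoc)
    qed
    finally show "\<bar>sqsum J (\<lambda>j. x j s') - sqsum J (\<lambda>j. x j s + (w j s' - w j s))\<bar> \<le> e * (s' - s)"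
      by simp
  qed (use \<delta> in auto)
qed

text \<open>The points with \<open>k\<close> from 0 to \<open>Suc n\<close> cut
  \<open>[0, t]\<close> into \<open>Suc n\<close> equal intervals; the shift makes every
  \<open>n\<close> a legitimate index of a sequence of grids.\<close>

definition grid :: "real \<Rightarrow> nat \<Rightarrow> nat \<Rightarrow> real" where
  "grid t n k = t * real k / real (Suc n)"

lemma grid_props:
  assumes "0 < t"
  shows "grid t n (Suc k) - grid t n k = t / real (Suc n)" "0 \<le> grid t n k"
    "grid t n k < grid t n (Suc k)" "k < Suc n \<Longrightarrow> grid t n (Suc k) \<le> t"
proof -
  show diff: "grid t n (Suc k) - grid t n k = t / real (Suc n)"
    by (simp add: grid_def diff_divide_distrib[symmetric] algebra_simps)
  have "t / real (Suc n) > 0" using assms by simp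
  then show "grid t n k < grid t n (Suc k)" using diff by linarith
  show "0 \<le> grid t n k" using assms by (simp add: grid_def)
  assume "k < Suc n"
  then have "t * real (Suc k) \<le> t * real (Suc n)"
    using assms by (intro mult_left_mono) auto
  then show "grid t n (Suc k) \<le> t"
    by (simp add: grid_def pos_divide_le_eq del: of_nat_Suc)
qed

text \<open>After telescoping the left part, only the discrepancy between the true and the
  noise-only endpoint of each interval remains. By the one-step estimate and the Lipschitz bound it
  is at most \<open>e\<close> times the interval length once the grid is fine.\<close>

lemma orthogonal_drift_grid:
  fixes x f w :: "'j \<Rightarrow> real \<Rightarrow> real"
  assumes J: "finite J" and t: "0 < t" "t \<le> T" and \<epsilon>: "\<epsilon> > 0"
    and x: "\<And>j. j \<in> J \<Longrightarrow> continuous_on {0..T} (x j)"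
    and f: "\<And>j. j \<in> J \<Longrightarrow> continuous_on {0..T} (f j)"
    and orth: "\<And>t. t \<in> {0..T} \<Longrightarrow> (\<Sum>j\<in>J. x j t * f j t) = 0"
    and eq: "\<And>j t. j \<in> J \<Longrightarrow> t \<in> {0..T} \<Longrightarrow> x j t = x j 0 + integral {0..t} (f j) + w j t"
  shows "(\<lambda>n. damp \<epsilon> (sqsum J (\<lambda>j. x j t)) - damp \<epsilon> (sqsum J (\<lambda>j. x j 0))
    - (\<Sum>k<Suc n. damp \<epsilon> (sqsum J (\<lambda>j. x j (grid t n k) + (w j (grid t n (Suc k)) - w j (grid t n k))))
        - damp \<epsilon> (sqsum J (\<lambda>j. x j (grid t n k))))) \<longlonglongrightarrow> 0" (is "?D \<longlonglongrightarrow> 0")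
proof (rule LIMSEQ_I)
  fix r :: real assume r: "r > 0"
  have T: "0 \<le> T" using t by simp
  \<comment> \<open>The errors add up to \<open>e * t\<close>, which this choice keeps below
    \<open>r\<close>.\<close>
  define e where "e = r / (t + 1)"
  have e: "e > 0" using r t by (simp add: e_def)
  obtain \<delta> where \<delta>: "\<delta> > 0" and step: "\<And>s s'. 0 \<le> s \<Longrightarrow> s \<le> s' \<Longrightarrow> s' \<le> T \<Longrightarrow> s' - s < \<delta> \<Longrightarrow>
      \<bar>sqsum J (\<lambda>j. x j s') - sqsum J (\<lambda>j. x j s + (w j s' - w j s))\<bar> \<le> e * (s' - s)"
    using orthogonal_drift_one_step[OF J T x f orth eq e] by blast
  obtain n0 where n0: "t / \<delta> < real n0"
    using reals_Archimedean2 by blast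
  show "\<exists>n0. \<forall>n\<ge>n0. norm (?D n - 0) < r"
  proof (intro exI[of _ n0] allI impI)
    fix n assume n: "n \<ge> n0"
    have small: "t / real (Suc n) < \<delta>"
    proof -
      have "t / \<delta> < real (Suc n)" using n0 n by linarith
      then show ?thesis using \<delta> by (simp add: divide_less_eq mult.commute)
    qed
    note diff = grid_props(1)[OF t(1), of n]
    have range: "0 \<le> grid t n k" "grid t n k \<le> grid t n (Suc k)" "k < Suc n \<Longrightarrow> grid t n (Suc k) \<le> T" for k
      using grid_props(2-4)[OF t(1), where n=n and k=k] t(2) by auto
    have "damp \<epsilon> (sqsum J (\<lambda>j. x j t)) - damp \<epsilon> (sqsum J (\<lambda>j. x j 0))
        = (\<Sum>k<Suc n. damp \<epsilon> (sqsum J (\<lambda>j. x j (grid t n (Suc k)))) - damp \<epsilon> (sqsum J (\<lambda>j. x j (grid t n k))))"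
      using sum_lessThan_telescope[of "\<lambda>k. damp \<epsilon> (sqsum J (\<lambda>j. x j (grid t n k)))" "Suc n"]
      by (simp add: grid_def del: of_nat_Suc sum.lessThan_Suc)
    then have "?D n = (\<Sum>k<Suc n. damp \<epsilon> (sqsum J (\<lambda>j. x j (grid t n (Suc k))))
        - damp \<epsilon> (sqsum J (\<lambda>j. x j (grid t n k) + (w j (grid t n (Suc k)) - w j (grid t n k)))))"
      by (simp only: sum_subtractf[symmetric]) simp
    also have "norm \<dots> \<le> (\<Sum>k<Suc n. e * (t / real (Suc n)))"
    proof (intro sum_norm_le)
      fix k assume "k \<in> {..<Suc n}"
      then have k: "k < Suc n" by simp
      show "norm (damp \<epsilon> (sqsum J (\<lambda>j. x j (grid t n (Suc k))))
        - damp \<epsilon> (sqsum J (\<lambda>j. x j (grid t n k) + (w j (grid t n (Suc k)) - w j (grid t n k))))) \<le> e * (t / real (Suc n))"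
        (is "norm (damp \<epsilon> ?a - damp \<epsilon> ?b) \<le> _")
      proof -
        have "norm (damp \<epsilon> ?a - damp \<epsilon> ?b) \<le> \<bar>?a - ?b\<bar>"
          unfolding real_norm_def by (intro damp_lipschitz \<epsilon> sum_nonneg zero_le_power2)
        also have "\<dots> \<le> e * (grid t n (Suc k) - grid t n k)"
          using small by (intro step range k) (simp only: diff)
        finally show ?thesis by (simp only: diff)
      qed
    qed
    also have "\<dots> = e * t" by (simp del: of_nat_Suc)
    also have "\<dots> < r"
      using r t by (simp add: e_def divide_less_eq)
    finally show "norm (?D n - 0) < r" by simp
  qed
qed

section \<open>Expectations\<close>

text \<open>Bounded second moments give uniform integrability through
  \<open>\<bar>d\<bar> \<le> min \<bar>d\<bar> K + d^2 / K\<close>: the truncated part tends to 0 by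
  dominated convergence, and the rest has expectation at most \<open>C / K\<close>.\<close>

lemma (in prob_space) expectation_tendsto_zero_if_L2_bounded:
  fixes D :: "nat \<Rightarrow> 'a \<Rightarrow> real"
  assumes [measurable]: "\<And>n. D n \<in> borel_measurable M"
    and lim: "AE \<omega> in M. (\<lambda>n. D n \<omega>) \<longlonglongrightarrow> 0"
    and int: "\<And>n. integrable M (\<lambda>\<omega>. (D n \<omega>)\<^sup>2)"
    and bound: "\<And>n. expectation (\<lambda>\<omega>. (D n \<omega>)\<^sup>2) \<le> C"
  shows "(\<lambda>n. expectation (D n)) \<longlonglongrightarrow> 0"
proof (rule LIMSEQ_I)
  fix e :: real assume e: "e > 0"
  have C: "C \<ge> 0"
    by (rule order_trans[OF Bochner_Integration.integral_nonneg bound[of 0]]) simp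
  \<comment> \<open>This makes \<open>(C + 1) / K = e / 2\<close>; using \<open>C + 1\<close> keeps
    \<open>K\<close> positive for \<open>C = 0\<close>.\<close>
  define K where "K = 2 * (C + 1) / e"
  have K: "K > 0" using e C by (simp add: K_def)
  have int1: "integrable M (D n)" for n
    by (rule square_integrable_imp_integrable[OF _ int]) simp
  have int_min: "integrable M (\<lambda>\<omega>. min \<bar>D n \<omega>\<bar> K)" for n
    by (rule integrable_const_bound[where B=K]) (use K in auto)
  have "(\<lambda>n. expectation (\<lambda>\<omega>. min \<bar>D n \<omega>\<bar> K)) \<longlonglongrightarrow> expectation (\<lambda>\<omega>. 0)"
  proof (rule integral_dominated_convergence[where w="\<lambda>_. K"])
    show "AE \<omega> in M. (\<lambda>n. min \<bar>D n \<omega>\<bar> K) \<longlonglongrightarrow> 0"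
      using lim
    proof eventually_elim
      case (elim \<omega>)
      then have "(\<lambda>n. min \<bar>D n \<omega>\<bar> K) \<longlonglongrightarrow> min \<bar>0\<bar> K"
        by (intro tendsto_intros)
      then show ?case using K by simp
    qed
  qed (use K in auto)
  then obtain n0 where n0: "\<And>n. n \<ge> n0 \<Longrightarrow> \<bar>expectation (\<lambda>\<omega>. min \<bar>D n \<omega>\<bar> K)\<bar> < e / 2"
    using LIMSEQ_D[of "\<lambda>n. expectation (\<lambda>\<omega>. min \<bar>D n \<omega>\<bar> K)" 0 "e / 2"] e
    by auto
  show "\<exists>n0. \<forall>n\<ge>n0. norm (expectation (D n) - 0) < e"
  proof (intro exI[of _ n0] allI impI)
    fix n assume n: "n \<ge> n0"
    have pt: "\<bar>d\<bar> \<le> min \<bar>d\<bar> K + d\<^sup>2 / K" for d :: real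
    proof (cases "\<bar>d\<bar> \<le> K")
      case False
      then have "\<bar>d\<bar> * K \<le> \<bar>d\<bar> * \<bar>d\<bar>" by (intro mult_left_mono) auto
      then have "\<bar>d\<bar> \<le> d\<^sup>2 / K"
        using K by (simp add: pos_le_divide_eq power2_eq_square)
      then show ?thesis using K by (simp add: min_def)
    qed (use K in \<open>simp add: min_def\<close>)
    have "\<bar>expectation (D n)\<bar> \<le> expectation (\<lambda>\<omega>. \<bar>D n \<omega>\<bar>)"
      by simp
    also have "\<dots> \<le> expectation (\<lambda>\<omega>. min \<bar>D n \<omega>\<bar> K + (D n \<omega>)\<^sup>2 / K)"
      by (intro integral_mono integrable_abs int1 Bochner_Integration.integrable_add int_min
          integrable_divide int pt)
    also have "\<dots> = expectation (\<lambda>\<omega>. min \<bar>D n \<omega>\<bar> K) + expectation (\<lambda>\<omega>. (D n \<omega>)\<^sup>2) / K"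
      by (subst Bochner_Integration.integral_add) (auto intro!: int_min integrable_divide int)
    also have "\<dots> < e / 2 + e / 2"
    proof (intro add_less_le_mono)
      show "expectation (\<lambda>\<omega>. min \<bar>D n \<omega>\<bar> K) < e / 2" using n0[OF n] by simp
      have "expectation (\<lambda>\<omega>. (D n \<omega>)\<^sup>2) / K \<le> (C + 1) / K"
        using bound[of n] K by (intro divide_right_mono) auto
      also have "\<dots> = e / 2" using C e by (simp add: K_def field_simps)
      finally show "expectation (\<lambda>\<omega>. (D n \<omega>)\<^sup>2) / K \<le> e / 2" .
    qed
    finally show "norm (expectation (D n) - 0) < e" by simp
  qed
qed

lemma centered_normal_moments:
  fixes Y :: "'a \<Rightarrow> real"
  assumes d: "distributed M lborel Y (normal_density 0 (sqrt \<tau>))" and \<tau>: "\<tau> > 0"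
  shows "integrable M Y" "integral\<^sup>L M Y = 0"
    "integrable M (\<lambda>\<omega>. (Y \<omega>)\<^sup>2)" "(\<integral>\<omega>. (Y \<omega>)\<^sup>2 \<partial>M) = \<tau>"
    "integrable M (\<lambda>\<omega>. (Y \<omega>) ^ 4)" "(\<integral>\<omega>. (Y \<omega>) ^ 4 \<partial>M) = 3 * \<tau>\<^sup>2"
proof -
  have pos: "sqrt \<tau> > 0" using \<tau> by simp
  have int: "integrable M (\<lambda>\<omega>. (Y \<omega>) ^ k)" for k
    using distributed_integrable[OF d, of "\<lambda>x. x ^ k"] integrable_normal_moment[OF pos, of 0 k] by simp
  have eq: "(\<integral>\<omega>. (Y \<omega>) ^ k \<partial>M) = (\<integral>x. normal_density 0 (sqrt \<tau>) x * x ^ k \<partial>lborel)" for k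
    using distributed_integral[OF d, of "\<lambda>x. x ^ k"] by simp
  show "integrable M Y" "integrable M (\<lambda>\<omega>. (Y \<omega>)\<^sup>2)" "integrable M (\<lambda>\<omega>. (Y \<omega>) ^ 4)"
    using int[of 1] int[of 2] int[of 4] by simp_all
  show "integral\<^sup>L M Y = 0"
    using eq[of 1] integral_normal_moment_odd[OF pos, of 0 0] by simp
  show "(\<integral>\<omega>. (Y \<omega>)\<^sup>2 \<partial>M) = \<tau>"
    using eq[of 2] integral_normal_moment_even[OF pos, of 0 1] \<tau> by simp
  show "(\<integral>\<omega>. (Y \<omega>) ^ 4 \<partial>M) = 3 * \<tau>\<^sup>2"
    using eq[of 4] integral_normal_moment_even[OF pos, of 0 2] \<tau>
    by (simp add: fact_numeral power2_eq_square)
qed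

lemma (in prob_space) indep_set_mono:
  assumes "indep_set A B" "A' \<subseteq> A" "B' \<subseteq> B"
  shows "indep_set A' B'"
  using assms(1) unfolding indep_set_def
  by (rule indep_sets_mono_sets) (use assms(2,3) in \<open>auto split: bool.splits\<close>)

text \<open>The substitute for conditioning: \<open>G\<close> is the past and \<open>Y\<close> a
  later increment. The algebras generated by \<open>Z\<close> and by \<open>g\<close> of
  \<open>Y\<close> lie inside the two independent ones, so the product rule for expectations
  applies.\<close>

lemma (in prob_space) indep_subalgebra_mult:
  fixes Y Z :: "'a \<Rightarrow> real"
  assumes sub: "subalgebra M G" and Y: "Y \<in> borel_measurable M"
    and indep: "indep_set (sets G) (sets (vimage_algebra (space M) Y borel))"
    and Z: "Z \<in> borel_measurable G" "integrable M Z"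
    and g: "g \<in> borel_measurable borel" "integrable M (\<lambda>\<omega>. g (Y \<omega>))"
  shows "integrable M (\<lambda>\<omega>. Z \<omega> * g (Y \<omega>))"
    "expectation (\<lambda>\<omega>. Z \<omega> * g (Y \<omega>)) = expectation Z * expectation (\<lambda>\<omega>. g (Y \<omega>))"
proof -
  have sp: "space G = space M"
    using sub by (simp add: subalgebra_def)
  have ZM: "Z \<in> borel_measurable M"
    by (rule measurable_from_subalg[OF sub Z(1)])
  have "indep_var borel Z borel (\<lambda>\<omega>. g (Y \<omega>))"
    unfolding indep_var_eq
  proof (intro conjI)
    show "random_variable borel Z" by fact
    show "random_variable borel (\<lambda>\<omega>. g (Y \<omega>))" using Y g by measurable
    have "sets (vimage_algebra (space M) Z borel) \<subseteq> sets G"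
      by (rule sets_image_in_sets[OF sp Z(1)])
    moreover have "sets (vimage_algebra (space M) (\<lambda>\<omega>. g (Y \<omega>)) borel)
      \<subseteq> sets (vimage_algebra (space M) Y borel)"
      by (intro sets_image_in_sets measurable_compose[OF measurable_vimage_algebra1 g(1)]) auto
    ultimately show "indep_set (sigma_sets (space M) {Z -` A \<inter> space M |A. A \<in> sets borel})
      (sigma_sets (space M) {(\<lambda>\<omega>. g (Y \<omega>)) -` A \<inter> space M |A. A \<in> sets borel})"
      unfolding sets_vimage_algebra[symmetric] by (rule indep_set_mono[OF indep])
  qed
  from indep_var_integrable[OF this Z(2) g(2)] indep_var_lebesgue_integral[OF this Z(2) g(2)]
  show "integrable M (\<lambda>\<omega>. Z \<omega> * g (Y \<omega>))"
    "expectation (\<lambda>\<omega>. Z \<omega> * g (Y \<omega>)) = expectation Z * expectation (\<lambda>\<omega>. g (Y \<omega>))"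
    by auto
qed

section \<open>Additive noise and orthogonal drift\<close>

text \<open>The solution as a single vector with additive noise and a drift orthogonal to it. The
  linear and squared noise terms are sums over single coordinates, so independence from the past is
  stated coordinatewise.\<close>

locale orthogonal_drift_sde = prob_space \<Omega> for \<Omega> :: "'a measure" +
  fixes F :: "real \<Rightarrow> 'a measure" and J :: "'j set" and X f :: "'j \<Rightarrow> real \<Rightarrow> 'a \<Rightarrow> real"
    and \<sigma> :: "'j \<Rightarrow> real" and B :: "'j \<Rightarrow> real \<Rightarrow> 'a \<Rightarrow> real" and x0 :: "'j \<Rightarrow> real" and T :: real
  assumes finite_J: "finite J"
    and subalg: "subalgebra \<Omega> (F t)"
    and F_mono: "s \<le> t \<Longrightarrow> sets (F s) \<subseteq> sets (F t)"
    and X_adapted: "j \<in> J \<Longrightarrow> t \<in> {0..T} \<Longrightarrow> X j t \<in> borel_measurable (F t)"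
    and X_cont: "j \<in> J \<Longrightarrow> AE \<omega> in \<Omega>. continuous_on {0..T} (\<lambda>t. X j t \<omega>)"
    and f_cont: "j \<in> J \<Longrightarrow> AE \<omega> in \<Omega>. continuous_on {0..T} (\<lambda>t. f j t \<omega>)"
    and orthogonal: "AE \<omega> in \<Omega>. \<forall>t\<in>{0..T}. (\<Sum>j\<in>J. X j t \<omega> * f j t \<omega>) = 0"
    and sde: "j \<in> J \<Longrightarrow> solves_sde \<Omega> T (X j) (f j) (\<sigma> j) (B j)"
    and X_0: "j \<in> J \<Longrightarrow> AE \<omega> in \<Omega>. X j 0 \<omega> = x0 j"
    and B_adapted: "j \<in> J \<Longrightarrow> 0 \<le> t \<Longrightarrow> B j t \<in> borel_measurable (F t)"
    and B_normal: "j \<in> J \<Longrightarrow> 0 \<le> s \<Longrightarrow> s < t \<Longrightarrow>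
      distributed \<Omega> lborel (\<lambda>\<omega>. B j t \<omega> - B j s \<omega>) (normal_density 0 (sqrt (t - s)))"
    and B_indep: "j \<in> J \<Longrightarrow> 0 \<le> s \<Longrightarrow> s \<le> t \<Longrightarrow>
      indep_set (sets (F s)) (sets (vimage_algebra (space \<Omega>) (\<lambda>\<omega>. B j t \<omega> - B j s \<omega>) borel))"
begin

text \<open>The growth rate of the expected squared norm of the noise.\<close>

definition \<kappa> :: real where
  "\<kappa> = sqsum J \<sigma>"

definition N :: "real \<Rightarrow> 'a \<Rightarrow> real" where
  "N t \<omega> = sqsum J (\<lambda>j. X j t \<omega>)"

definition noise :: "real \<Rightarrow> real \<Rightarrow> 'a \<Rightarrow> 'j \<Rightarrow> real" where
  "noise s t \<omega> j = \<sigma> j * (B j t \<omega> - B j s \<omega>)"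

definition noise_sq :: "real \<Rightarrow> real \<Rightarrow> 'a \<Rightarrow> real" where
  "noise_sq s t \<omega> = sqsum J (noise s t \<omega>)"

text \<open>Half the gradient of the damped squared norm at the solution; the factor 2 reappears in
  \<open>step_eq\<close>.\<close>

definition grad :: "real \<Rightarrow> real \<Rightarrow> 'a \<Rightarrow> 'j \<Rightarrow> real" where
  "grad \<epsilon> s \<omega> j = X j s \<omega> / (1 + \<epsilon> * N s \<omega>)\<^sup>2"

definition lin :: "real \<Rightarrow> real \<Rightarrow> real \<Rightarrow> 'a \<Rightarrow> real" where
  "lin \<epsilon> s t \<omega> = (\<Sum>j\<in>J. grad \<epsilon> s \<omega> j * noise s t \<omega> j)"

definition rem :: "real \<Rightarrow> real \<Rightarrow> real \<Rightarrow> 'a \<Rightarrow> real" where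
  "rem \<epsilon> s t \<omega> = damp_rem \<epsilon> J (\<lambda>j. X j s \<omega>) (noise s t \<omega>)"

text \<open>The change of the damped charge over \<open>[s, t]\<close> if only the noise acts.\<close>

definition step :: "real \<Rightarrow> real \<Rightarrow> real \<Rightarrow> 'a \<Rightarrow> real" where
  "step \<epsilon> s t \<omega> = damp \<epsilon> (sqsum J (\<lambda>j. X j s \<omega> + noise s t \<omega> j)) - damp \<epsilon> (N s \<omega>)"

section \<open>Signs, adaptedness and measurability\<close>

lemma \<kappa>_nonneg: "\<kappa> \<ge> 0"
  by (simp add: \<kappa>_def sum_nonneg)

lemma N_nonneg: "N t \<omega> \<ge> 0"
  by (simp add: N_def sum_nonneg)

lemma noise_sq_nonneg: "noise_sq s t \<omega> \<ge> 0"
  by (simp add: noise_sq_def sum_nonneg)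

lemma F_measurable_mono:
  assumes "s \<le> t" "g \<in> borel_measurable (F s)"
  shows "g \<in> borel_measurable (F t)"
proof (rule measurable_from_subalg)
  show "subalgebra (F t) (F s)"
    using F_mono[OF assms(1)] subalg[of s] subalg[of t] by (simp add: subalgebra_def)
qed fact

lemma F_measurable: "g \<in> borel_measurable (F s) \<Longrightarrow> g \<in> borel_measurable \<Omega>"
  by (rule measurable_from_subalg[OF subalg])

lemma N_adapted: "t \<in> {0..T} \<Longrightarrow> N t \<in> borel_measurable (F t)"
  unfolding N_def[abs_def] by (intro borel_measurable_sum borel_measurable_power X_adapted)

lemma grad_adapted: "j \<in> J \<Longrightarrow> t \<in> {0..T} \<Longrightarrow> (\<lambda>\<omega>. grad \<epsilon> t \<omega> j) \<in> borel_measurable (F t)"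
  unfolding grad_def[abs_def]
  by (intro borel_measurable_divide borel_measurable_power borel_measurable_add
      borel_measurable_times borel_measurable_const X_adapted N_adapted)

lemma noise_adapted:
  assumes "j \<in> J" "0 \<le> s" "s \<le> t"
  shows "(\<lambda>\<omega>. noise s t \<omega> j) \<in> borel_measurable (F t)"
  unfolding noise_def using assms
  by (intro borel_measurable_times borel_measurable_diff borel_measurable_const B_adapted
      F_measurable_mono[OF assms(3) B_adapted]) auto

lemma lin_adapted:
  assumes "0 \<le> s" "s \<le> t" "t \<le> T"
  shows "lin \<epsilon> s t \<in> borel_measurable (F t)"
  unfolding lin_def[abs_def] using assms
  by (intro borel_measurable_sum borel_measurable_times noise_adapted
      F_measurable_mono[OF assms(2) grad_adapted]) auto

lemma N_measurable: "t \<in> {0..T} \<Longrightarrow> N t \<in> borel_measurable \<Omega>"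
  by (rule F_measurable[OF N_adapted])

lemma noise_sq_measurable:
  assumes "0 \<le> s" "s \<le> t"
  shows "noise_sq s t \<in> borel_measurable \<Omega>"
  unfolding noise_sq_def[abs_def] using assms
  by (intro borel_measurable_sum borel_measurable_power F_measurable[OF noise_adapted])

lemma step_measurable:
  assumes "0 \<le> s" "s \<le> t" "t \<le> T"
  shows "step \<epsilon> s t \<in> borel_measurable \<Omega>"
proof -
  have "(\<lambda>\<omega>. damp \<epsilon> (sqsum J (\<lambda>j. X j s \<omega> + noise s t \<omega> j))) \<in> borel_measurable \<Omega>"
    using assms
    by (intro measurable_compose[OF _ damp_measurable] borel_measurable_sum borel_measurable_power
        borel_measurable_add F_measurable[OF X_adapted] F_measurable[OF noise_adapted]) auto
  moreover have "(\<lambda>\<omega>. damp \<epsilon> (N s \<omega>)) \<in> borel_measurable \<Omega>"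
    using assms by (intro measurable_compose[OF _ damp_measurable] N_measurable) auto
  ultimately show ?thesis
    unfolding step_def[abs_def] by (rule borel_measurable_diff)
qed

section \<open>Boundedness and expansion of a single step\<close>

lemma damp_integrable:
  assumes "\<epsilon> > 0" "g \<in> borel_measurable \<Omega>" "\<And>\<omega>. g \<omega> \<ge> 0"
  shows "integrable \<Omega> (\<lambda>\<omega>. damp \<epsilon> (g \<omega>))"
  using damp_bounds(1,3)[OF assms(1) assms(3)]
  by (intro integrable_const_bound[where B="1 / \<epsilon>"] measurable_compose[OF assms(2) damp_measurable])
    (auto intro!: AE_I2)

lemma step_bound:
  assumes "\<epsilon> > 0"
  shows "\<bar>step \<epsilon> s t \<omega>\<bar> \<le> 1 / \<epsilon>"
proof -
  have "sqsum J (\<lambda>j. X j s \<omega> + noise s t \<omega> j) \<ge> 0"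
    by (simp add: sum_nonneg)
  from damp_bounds(1,3)[OF assms this] damp_bounds(1,3)[OF assms N_nonneg[of s \<omega>]]
  show ?thesis unfolding step_def by linarith
qed

lemma step_integrable:
  assumes "\<epsilon> > 0" "0 \<le> s" "s \<le> t" "t \<le> T"
  shows "integrable \<Omega> (step \<epsilon> s t)"
  using step_bound[OF assms(1)]
  by (intro integrable_const_bound[where B="1 / \<epsilon>"] step_measurable[OF assms(2-4)] AE_I2) simp

text \<open>The terms are a martingale increment, the Ito correction weighted by the derivative of
  \<open>damp \<epsilon>\<close>, and the Taylor remainder.\<close>

lemma step_eq:
  assumes "\<epsilon> > 0"
  shows "step \<epsilon> s t \<omega> = 2 * lin \<epsilon> s t \<omega> + noise_sq s t \<omega> / (1 + \<epsilon> * N s \<omega>)\<^sup>2 - rem \<epsilon> s t \<omega>"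
  using damp_increment[OF assms, where J=J and x="\<lambda>j. X j s \<omega>" and w="noise s t \<omega>"]
  by (simp add: step_def lin_def grad_def noise_sq_def rem_def N_def)

lemma damping_factor:
  assumes "\<epsilon> > 0"
  shows "0 \<le> 1 / (1 + \<epsilon> * N s \<omega>)\<^sup>2" "1 / (1 + \<epsilon> * N s \<omega>)\<^sup>2 \<le> 1"
    "1 - 2 * \<epsilon> * N s \<omega> \<le> 1 / (1 + \<epsilon> * N s \<omega>)\<^sup>2"
proof -
  have y: "\<epsilon> * N s \<omega> \<ge> 0" using assms N_nonneg by simp
  show "0 \<le> 1 / (1 + \<epsilon> * N s \<omega>)\<^sup>2" by simp
  show "1 / (1 + \<epsilon> * N s \<omega>)\<^sup>2 \<le> 1"
    using one_le_power[of "1 + \<epsilon> * N s \<omega>" 2] y by simp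
  show "1 - 2 * \<epsilon> * N s \<omega> \<le> 1 / (1 + \<epsilon> * N s \<omega>)\<^sup>2"
    using inverse_square_ge[OF y] by (simp add: mult.assoc)
qed

section \<open>Moments of the noise\<close>

lemma noise_sq_eq: "noise_sq s t \<omega> = (\<Sum>j\<in>J. (\<sigma> j)\<^sup>2 * (B j t \<omega> - B j s \<omega>)\<^sup>2)"
  by (simp add: noise_sq_def noise_def power_mult_distrib)

lemma B_increment_measurable:
  assumes "j \<in> J" "0 \<le> s" "s \<le> t"
  shows "(\<lambda>\<omega>. B j t \<omega> - B j s \<omega>) \<in> borel_measurable \<Omega>"
  using assms by (intro borel_measurable_diff F_measurable[OF B_adapted]) auto

text \<open>Each squared increment has mean \<open>t - s\<close> and is independent of the weight
  \<open>Z\<close>, which is known at time \<open>s\<close>.\<close>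

lemma noise_sq_expectation:
  assumes st: "0 \<le> s" "s < t"
    and Z: "Z \<in> borel_measurable (F s)" "integrable \<Omega> Z"
  shows "integrable \<Omega> (\<lambda>\<omega>. Z \<omega> * noise_sq s t \<omega>)"
    "expectation (\<lambda>\<omega>. Z \<omega> * noise_sq s t \<omega>) = expectation Z * (\<kappa> * (t - s))"
proof -
  have eq: "(\<lambda>\<omega>. Z \<omega> * noise_sq s t \<omega>)
      = (\<lambda>\<omega>. \<Sum>j\<in>J. (\<sigma> j)\<^sup>2 * (Z \<omega> * (B j t \<omega> - B j s \<omega>)\<^sup>2))"
    by (simp add: noise_sq_eq sum_distrib_left algebra_simps)
  have int: "integrable \<Omega> (\<lambda>\<omega>. Z \<omega> * (B j t \<omega> - B j s \<omega>)\<^sup>2)"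
    and ex: "expectation (\<lambda>\<omega>. Z \<omega> * (B j t \<omega> - B j s \<omega>)\<^sup>2) = expectation Z * (t - s)" if "j \<in> J" for j
    using indep_subalgebra_mult[OF subalg B_increment_measurable[OF that st(1) less_imp_le[OF st(2)]]
        B_indep[OF that st(1) less_imp_le[OF st(2)]] Z, of "\<lambda>y. y\<^sup>2"]
      centered_normal_moments[OF B_normal[OF that st]] st by simp_all
  show "integrable \<Omega> (\<lambda>\<omega>. Z \<omega> * noise_sq s t \<omega>)"
    unfolding eq by (intro Bochner_Integration.integrable_sum integrable_mult_right int)
  have "expectation (\<lambda>\<omega>. Z \<omega> * noise_sq s t \<omega>) = (\<Sum>j\<in>J. (\<sigma> j)\<^sup>2 * (expectation Z * (t - s)))"
    unfolding eq by (subst Bochner_Integration.integral_sum) (simp_all add: int ex)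
  also have "\<dots> = \<kappa> * (expectation Z * (t - s))"
    unfolding \<kappa>_def by (simp only: sum_distrib_right)
  finally show "expectation (\<lambda>\<omega>. Z \<omega> * noise_sq s t \<omega>) = expectation Z * (\<kappa> * (t - s))"
    by simp
qed

text \<open>For the second moment, one factor \<open>\<sigma> j\<close> is split off before
  Cauchy-Schwarz, which leaves \<kappa> times a weighted sum of fourth powers. The Gaussian fourth
  moment supplies the 3.\<close>

lemma noise_sq_moments:
  assumes st: "0 \<le> s" "s < t"
  shows "integrable \<Omega> (noise_sq s t)" "expectation (noise_sq s t) = \<kappa> * (t - s)"
    "integrable \<Omega> (\<lambda>\<omega>. (noise_sq s t \<omega>)\<^sup>2)"
    "expectation (\<lambda>\<omega>. (noise_sq s t \<omega>)\<^sup>2) \<le> 3 * \<kappa>\<^sup>2 * (t - s)\<^sup>2"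
proof -
  show "integrable \<Omega> (noise_sq s t)" "expectation (noise_sq s t) = \<kappa> * (t - s)"
    using noise_sq_expectation[OF st borel_measurable_const[of 1] integrable_const]
    by (simp_all add: prob_space)
  have bound: "(noise_sq s t \<omega>)\<^sup>2 \<le> \<kappa> * (\<Sum>j\<in>J. (\<sigma> j)\<^sup>2 * (B j t \<omega> - B j s \<omega>) ^ 4)" for \<omega>
  proof -
    have "noise_sq s t \<omega> = (\<Sum>j\<in>J. \<sigma> j * (\<sigma> j * (B j t \<omega> - B j s \<omega>)\<^sup>2))"
      by (simp add: noise_sq_eq power2_eq_square mult.assoc)
    then have "(noise_sq s t \<omega>)\<^sup>2 \<le> \<kappa> * (\<Sum>j\<in>J. (\<sigma> j * (B j t \<omega> - B j s \<omega>)\<^sup>2)\<^sup>2)"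
      using Cauchy_Schwarz_ineq_sum by (simp add: \<kappa>_def)
    then show ?thesis by (simp add: power_mult_distrib flip: power_mult)
  qed
  have int: "integrable \<Omega> (\<lambda>\<omega>. \<kappa> * (\<Sum>j\<in>J. (\<sigma> j)\<^sup>2 * (B j t \<omega> - B j s \<omega>) ^ 4))"
    by (intro Bochner_Integration.integrable_sum integrable_mult_right
        centered_normal_moments(5)[OF B_normal[OF _ st]]) (use st in simp_all)
  have meas: "(\<lambda>\<omega>. (noise_sq s t \<omega>)\<^sup>2) \<in> borel_measurable \<Omega>"
    using st by (intro borel_measurable_power noise_sq_measurable) auto
  show int2: "integrable \<Omega> (\<lambda>\<omega>. (noise_sq s t \<omega>)\<^sup>2)"
    by (rule Bochner_Integration.integrable_bound[OF int meas])
      (intro AE_I2, use order_trans[OF bound abs_ge_self] in simp)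
  have "expectation (\<lambda>\<omega>. (noise_sq s t \<omega>)\<^sup>2)
      \<le> expectation (\<lambda>\<omega>. \<kappa> * (\<Sum>j\<in>J. (\<sigma> j)\<^sup>2 * (B j t \<omega> - B j s \<omega>) ^ 4))"
    by (intro integral_mono int int2 bound)
  also have "\<dots> = \<kappa> * (\<Sum>j\<in>J. (\<sigma> j)\<^sup>2 * (3 * (t - s)\<^sup>2))"
    using centered_normal_moments(5,6)[OF B_normal[OF _ st]] st by simp
  also have "\<dots> = \<kappa> * (\<kappa> * (3 * (t - s)\<^sup>2))"
    unfolding \<kappa>_def by (simp only: sum_distrib_right)
  also have "\<dots> = 3 * \<kappa>\<^sup>2 * (t - s)\<^sup>2"
    by (simp add: power2_eq_square)
  finally show "expectation (\<lambda>\<omega>. (noise_sq s t \<omega>)\<^sup>2) \<le> 3 * \<kappa>\<^sup>2 * (t - s)\<^sup>2" .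
qed

section \<open>The linear part: centering and orthogonality\<close>

lemma noise_linear_expectation:
  assumes st: "0 \<le> s" "s < t"
    and Z: "\<And>j. j \<in> J \<Longrightarrow> Z j \<in> borel_measurable (F s)" "\<And>j. j \<in> J \<Longrightarrow> integrable \<Omega> (Z j)"
  shows "integrable \<Omega> (\<lambda>\<omega>. \<Sum>j\<in>J. Z j \<omega> * noise s t \<omega> j)"
    "expectation (\<lambda>\<omega>. \<Sum>j\<in>J. Z j \<omega> * noise s t \<omega> j) = 0"
proof -
  have eq: "(\<lambda>\<omega>. \<Sum>j\<in>J. Z j \<omega> * noise s t \<omega> j)
      = (\<lambda>\<omega>. \<Sum>j\<in>J. \<sigma> j * (Z j \<omega> * (B j t \<omega> - B j s \<omega>)))"
    by (simp add: noise_def algebra_simps)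
  have int: "integrable \<Omega> (\<lambda>\<omega>. Z j \<omega> * (B j t \<omega> - B j s \<omega>))"
    and ex: "expectation (\<lambda>\<omega>. Z j \<omega> * (B j t \<omega> - B j s \<omega>)) = 0" if "j \<in> J" for j
    using indep_subalgebra_mult[OF subalg B_increment_measurable[OF that st(1) less_imp_le[OF st(2)]]
        B_indep[OF that st(1) less_imp_le[OF st(2)]] Z[OF that], of "\<lambda>y. y"]
      centered_normal_moments(1,2)[OF B_normal[OF that st]] st by simp_all
  show "integrable \<Omega> (\<lambda>\<omega>. \<Sum>j\<in>J. Z j \<omega> * noise s t \<omega> j)"
    unfolding eq by (intro Bochner_Integration.integrable_sum integrable_mult_right int)
  show "expectation (\<lambda>\<omega>. \<Sum>j\<in>J. Z j \<omega> * noise s t \<omega> j) = 0"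
    unfolding eq by (subst Bochner_Integration.integral_sum) (simp_all add: int ex)
qed

lemma grad_bound:
  assumes "\<epsilon> > 0"
  shows "sqsum J (grad \<epsilon> s \<omega>) \<le> 1 / \<epsilon>"
  using damp_gradient_bound[OF assms, where J=J and x="\<lambda>j. X j s \<omega>"] by (simp add: grad_def N_def)

lemma grad_abs_bound:
  assumes "\<epsilon> > 0" "j \<in> J"
  shows "\<bar>grad \<epsilon> s \<omega> j\<bar> \<le> sqrt (1 / \<epsilon>)"
proof -
  have "(grad \<epsilon> s \<omega> j)\<^sup>2 \<le> sqsum J (grad \<epsilon> s \<omega>)"
    using assms finite_J by (intro member_le_sum) auto
  also have "\<dots> \<le> 1 / \<epsilon>" by (rule grad_bound[OF assms(1)])
  finally show ?thesis by (intro real_le_rsqrt) simp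
qed

lemma mult_grad_integrable:
  assumes "\<epsilon> > 0" "j \<in> J" "s \<in> {0..T}" "integrable \<Omega> Z"
  shows "integrable \<Omega> (\<lambda>\<omega>. Z \<omega> * grad \<epsilon> s \<omega> j)"
proof (rule Bochner_Integration.integrable_bound)
  show "integrable \<Omega> (\<lambda>\<omega>. sqrt (1 / \<epsilon>) * Z \<omega>)" using assms by simp
  show "(\<lambda>\<omega>. Z \<omega> * grad \<epsilon> s \<omega> j) \<in> borel_measurable \<Omega>"
    using assms by (intro borel_measurable_times F_measurable[OF grad_adapted]) auto
  show "AE \<omega> in \<Omega>. norm (Z \<omega> * grad \<epsilon> s \<omega> j) \<le> norm (sqrt (1 / \<epsilon>) * Z \<omega>)"
    using mult_left_mono[OF grad_abs_bound[OF assms(1,2)] abs_ge_zero] assms(1)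
    by (intro AE_I2) (simp add: abs_mult mult.commute)
qed

text \<open>\<open>Z = 1\<close> gives mean zero, and \<open>Z\<close> the sum of earlier linear
  terms gives orthogonality of the increments. As \<open>grad\<close> is bounded and known at time
  \<open>s\<close>, its product with \<open>Z\<close> is again an admissible weight.\<close>

lemma lin_expectation:
  assumes "\<epsilon> > 0" "0 \<le> s" "s < t" "t \<le> T"
    and Z: "Z \<in> borel_measurable (F s)" "integrable \<Omega> Z"
  shows "integrable \<Omega> (\<lambda>\<omega>. Z \<omega> * lin \<epsilon> s t \<omega>)" "expectation (\<lambda>\<omega>. Z \<omega> * lin \<epsilon> s t \<omega>) = 0"
proof -
  have eq: "(\<lambda>\<omega>. Z \<omega> * lin \<epsilon> s t \<omega>) = (\<lambda>\<omega>. \<Sum>j\<in>J. (Z \<omega> * grad \<epsilon> s \<omega> j) * noise s t \<omega> j)"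
    by (simp add: lin_def sum_distrib_left mult.assoc)
  have 1: "(\<lambda>\<omega>. Z \<omega> * grad \<epsilon> s \<omega> j) \<in> borel_measurable (F s)" if "j \<in> J" for j
    using assms that by (intro borel_measurable_times grad_adapted) auto
  have 2: "integrable \<Omega> (\<lambda>\<omega>. Z \<omega> * grad \<epsilon> s \<omega> j)" if "j \<in> J" for j
    using assms that by (intro mult_grad_integrable) auto
  show "integrable \<Omega> (\<lambda>\<omega>. Z \<omega> * lin \<epsilon> s t \<omega>)" "expectation (\<lambda>\<omega>. Z \<omega> * lin \<epsilon> s t \<omega>) = 0"
    unfolding eq by (rule noise_linear_expectation[OF assms(2,3) 1 2]; assumption)+
qed

lemma lin_sq_bound:
  assumes "\<epsilon> > 0"
  shows "(lin \<epsilon> s t \<omega>)\<^sup>2 \<le> 1 / \<epsilon> * noise_sq s t \<omega>"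
proof -
  have "(lin \<epsilon> s t \<omega>)\<^sup>2 \<le> sqsum J (grad \<epsilon> s \<omega>) * noise_sq s t \<omega>"
    unfolding lin_def noise_sq_def by (rule Cauchy_Schwarz_ineq_sum)
  also have "\<dots> \<le> 1 / \<epsilon> * noise_sq s t \<omega>"
    by (intro mult_right_mono grad_bound assms noise_sq_nonneg)
  finally show ?thesis .
qed

lemma lin_sq_integrable:
  assumes "\<epsilon> > 0" "0 \<le> s" "s < t" "t \<le> T"
  shows "integrable \<Omega> (\<lambda>\<omega>. (lin \<epsilon> s t \<omega>)\<^sup>2)"
    "expectation (\<lambda>\<omega>. (lin \<epsilon> s t \<omega>)\<^sup>2) \<le> \<kappa> * (t - s) / \<epsilon>"
proof -
  have int: "integrable \<Omega> (\<lambda>\<omega>. 1 / \<epsilon> * noise_sq s t \<omega>)"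
    by (intro integrable_mult_right noise_sq_moments(1)) (use assms in auto)
  have meas: "(\<lambda>\<omega>. (lin \<epsilon> s t \<omega>)\<^sup>2) \<in> borel_measurable \<Omega>"
    using assms by (intro borel_measurable_power F_measurable[OF lin_adapted]) auto
  show int2: "integrable \<Omega> (\<lambda>\<omega>. (lin \<epsilon> s t \<omega>)\<^sup>2)"
    by (rule Bochner_Integration.integrable_bound[OF int meas])
      (use lin_sq_bound[OF assms(1)] noise_sq_nonneg assms(1) in \<open>auto intro!: AE_I2\<close>)
  have "expectation (\<lambda>\<omega>. (lin \<epsilon> s t \<omega>)\<^sup>2) \<le> expectation (\<lambda>\<omega>. 1 / \<epsilon> * noise_sq s t \<omega>)"
    by (intro integral_mono int int2 lin_sq_bound assms)
  also have "\<dots> = \<kappa> * (t - s) / \<epsilon>"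
    using noise_sq_moments(2)[OF assms(2,3)] by simp
  finally show "expectation (\<lambda>\<omega>. (lin \<epsilon> s t \<omega>)\<^sup>2) \<le> \<kappa> * (t - s) / \<epsilon>" .
qed

text \<open>Orthogonality makes the second moments add up and the interval lengths telescope, so the
  bound depends on the number of intervals only through \<open>\<tau> n\<close>. Measurability of
  the partial sum belongs to the induction claim because it makes the next cross term
  vanish.\<close>

lemma lin_sum_L2:
  assumes \<epsilon>: "\<epsilon> > 0" and \<tau>: "0 \<le> \<tau> 0" "\<And>k. k < n \<Longrightarrow> \<tau> k < \<tau> (Suc k)" "\<And>k. k < n \<Longrightarrow> \<tau> (Suc k) \<le> T"
    and T0: "\<tau> 0 \<le> T"
  shows "(\<lambda>\<omega>. \<Sum>k<n. lin \<epsilon> (\<tau> k) (\<tau> (Suc k)) \<omega>) \<in> borel_measurable (F (\<tau> n)) \<and>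
    0 \<le> \<tau> n \<and> \<tau> n \<le> T \<and>
    integrable \<Omega> (\<lambda>\<omega>. (\<Sum>k<n. lin \<epsilon> (\<tau> k) (\<tau> (Suc k)) \<omega>)\<^sup>2) \<and>
    expectation (\<lambda>\<omega>. (\<Sum>k<n. lin \<epsilon> (\<tau> k) (\<tau> (Suc k)) \<omega>)\<^sup>2) \<le> \<kappa> * (\<tau> n - \<tau> 0) / \<epsilon>"
  using \<tau> T0
proof (induction n)
  case (Suc n)
  define S where "S \<omega> = (\<Sum>k<n. lin \<epsilon> (\<tau> k) (\<tau> (Suc k)) \<omega>)" for \<omega>
  define a where "a = lin \<epsilon> (\<tau> n) (\<tau> (Suc n))"
  have S: "S \<in> borel_measurable (F (\<tau> n))" "0 \<le> \<tau> n" "\<tau> n \<le> T"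
    "integrable \<Omega> (\<lambda>\<omega>. (S \<omega>)\<^sup>2)" "expectation (\<lambda>\<omega>. (S \<omega>)\<^sup>2) \<le> \<kappa> * (\<tau> n - \<tau> 0) / \<epsilon>"
    using Suc.IH[OF Suc.prems(1) Suc.prems(2)[OF less_SucI] Suc.prems(3)[OF less_SucI] Suc.prems(4)]
    unfolding S_def[abs_def] by (simp_all only: simp_thms)
  have \<tau>n: "\<tau> n < \<tau> (Suc n)" "\<tau> (Suc n) \<le> T"
    by (auto intro: Suc.prems(2,3))
  have Sint: "integrable \<Omega> S"
    by (rule square_integrable_imp_integrable[OF F_measurable[OF S(1)] S(4)])
  note a = lin_sq_integrable[OF \<epsilon> S(2) \<tau>n, folded a_def]
  note Sa = lin_expectation[OF \<epsilon> S(2) \<tau>n S(1) Sint, folded a_def]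
  have sum: "(\<Sum>k<Suc n. lin \<epsilon> (\<tau> k) (\<tau> (Suc k)) \<omega>) = S \<omega> + a \<omega>" for \<omega>
    by (simp add: S_def a_def)
  have sq: "(\<lambda>\<omega>. (S \<omega> + a \<omega>)\<^sup>2) = (\<lambda>\<omega>. (S \<omega>)\<^sup>2 + (a \<omega>)\<^sup>2 + 2 * (S \<omega> * a \<omega>))"
    by (simp add: power2_sum mult.assoc)
  have meas: "(\<lambda>\<omega>. S \<omega> + a \<omega>) \<in> borel_measurable (F (\<tau> (Suc n)))"
    unfolding a_def using S \<tau>n
    by (intro borel_measurable_add lin_adapted F_measurable_mono[OF _ S(1)]) auto
  have int: "integrable \<Omega> (\<lambda>\<omega>. (S \<omega> + a \<omega>)\<^sup>2)"
    unfolding sq by (intro Bochner_Integration.integrable_add integrable_mult_right S a Sa)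
  have "expectation (\<lambda>\<omega>. (S \<omega> + a \<omega>)\<^sup>2) = expectation (\<lambda>\<omega>. (S \<omega>)\<^sup>2) + expectation (\<lambda>\<omega>. (a \<omega>)\<^sup>2)"
    unfolding sq using S a Sa by simp
  also have "\<dots> \<le> \<kappa> * (\<tau> n - \<tau> 0) / \<epsilon> + \<kappa> * (\<tau> (Suc n) - \<tau> n) / \<epsilon>"
    by (intro add_mono S a)
  also have "\<dots> = \<kappa> * (\<tau> (Suc n) - \<tau> 0) / \<epsilon>"
    by (simp add: add_divide_distrib[symmetric] algebra_simps)
  finally have "expectation (\<lambda>\<omega>. (S \<omega> + a \<omega>)\<^sup>2) \<le> \<kappa> * (\<tau> (Suc n) - \<tau> 0) / \<epsilon>" .
  moreover have "0 \<le> \<tau> (Suc n)" using S \<tau>n by simp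
  ultimately show ?case
    unfolding sum by (intro conjI meas int \<tau>n(2))
qed auto

section \<open>Expectation and second moment of the noise steps\<close>

lemma rem_bounds:
  assumes "\<epsilon> > 0"
  shows "0 \<le> rem \<epsilon> s t \<omega>" "rem \<epsilon> s t \<omega> \<le> 4 * noise_sq s t \<omega>"
    "rem \<epsilon> s t \<omega> \<le> 6 * \<epsilon> * (N s \<omega> * noise_sq s t \<omega>) + 4 * \<epsilon> * (noise_sq s t \<omega>)\<^sup>2"
  using damp_rem_bounds[OF assms, where J=J and x="\<lambda>j. X j s \<omega>" and w="noise s t \<omega>"]
  by (simp_all add: rem_def N_def noise_sq_def power2_eq_square algebra_simps)

lemma factor_adapted:
  assumes "s \<in> {0..T}"
  shows "(\<lambda>\<omega>. 1 / (1 + \<epsilon> * N s \<omega>)\<^sup>2) \<in> borel_measurable (F s)"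
  using assms by (intro borel_measurable_divide borel_measurable_power borel_measurable_add
      borel_measurable_times borel_measurable_const N_adapted)

lemma factor_integrable:
  assumes "\<epsilon> > 0" "s \<in> {0..T}"
  shows "integrable \<Omega> (\<lambda>\<omega>. 1 / (1 + \<epsilon> * N s \<omega>)\<^sup>2)"
  using damping_factor[OF assms(1)]
  by (intro integrable_const_bound[where B=1] F_measurable[OF factor_adapted] assms AE_I2)
    (simp_all add: abs_of_nonneg del: zero_le_divide_1_iff)

text \<open>The linear term has mean zero, and the damping factor is known at time \<open>s\<close>,
  so the quadratic term factors. Integrability of the remainder is read off the expansion solved for
  \<open>rem\<close>, since \<open>step\<close> is bounded.\<close>

lemma step_expectation:
  assumes \<epsilon>: "\<epsilon> > 0" and st: "0 \<le> s" "s < t" "t \<le> T"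
  shows "integrable \<Omega> (rem \<epsilon> s t)"
    "expectation (step \<epsilon> s t)
      = expectation (\<lambda>\<omega>. 1 / (1 + \<epsilon> * N s \<omega>)\<^sup>2) * (\<kappa> * (t - s)) - expectation (rem \<epsilon> s t)"
proof -
  have s: "s \<in> {0..T}" using st by auto
  note l = lin_expectation[OF \<epsilon> st borel_measurable_const[of 1] integrable_const, simplified]
  note n = noise_sq_expectation[OF st(1,2) factor_adapted[OF s] factor_integrable[OF \<epsilon> s]]
  have rem_eq: "rem \<epsilon> s t = (\<lambda>\<omega>. 2 * lin \<epsilon> s t \<omega>
      + 1 / (1 + \<epsilon> * N s \<omega>)\<^sup>2 * noise_sq s t \<omega> - step \<epsilon> s t \<omega>)"
    using step_eq[OF \<epsilon>, of s t] by (intro ext) simp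
  note i = step_integrable[OF \<epsilon> st(1) less_imp_le[OF st(2)] st(3)]
  show "integrable \<Omega> (rem \<epsilon> s t)"
    unfolding rem_eq
    by (intro Bochner_Integration.integrable_diff Bochner_Integration.integrable_add
        integrable_mult_right l(1) n(1) i)
  have "expectation (rem \<epsilon> s t) = 2 * expectation (lin \<epsilon> s t)
      + expectation (\<lambda>\<omega>. 1 / (1 + \<epsilon> * N s \<omega>)\<^sup>2 * noise_sq s t \<omega>) - expectation (step \<epsilon> s t)"
    unfolding rem_eq
    by (subst Bochner_Integration.integral_diff Bochner_Integration.integral_add
        integral_mult_right_zero;
        (intro Bochner_Integration.integrable_add integrable_mult_right l(1) n(1) i)?)+
       simp
  then show "expectation (step \<epsilon> s t)
      = expectation (\<lambda>\<omega>. 1 / (1 + \<epsilon> * N s \<omega>)\<^sup>2) * (\<kappa> * (t - s)) - expectation (rem \<epsilon> s t)"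
    unfolding n(2) l(2) by simp
qed

text \<open>Both effects of concavity point downwards: the damping factor is at most 1 and the
  remainder is subtracted.\<close>

lemma step_upper:
  assumes \<epsilon>: "\<epsilon> > 0" and st: "0 \<le> s" "s < t" "t \<le> T"
  shows "expectation (step \<epsilon> s t) \<le> \<kappa> * (t - s)"
proof -
  have s: "s \<in> {0..T}" using st by auto
  have "expectation (\<lambda>\<omega>. 1 / (1 + \<epsilon> * N s \<omega>)\<^sup>2) \<le> expectation (\<lambda>\<omega>. 1)"
    by (intro integral_mono factor_integrable \<epsilon> s integrable_const damping_factor)
  then have "expectation (\<lambda>\<omega>. 1 / (1 + \<epsilon> * N s \<omega>)\<^sup>2) * (\<kappa> * (t - s)) \<le> 1 * (\<kappa> * (t - s))"
    using \<kappa>_nonneg st by (intro mult_right_mono) (simp_all add: prob_space)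
  moreover have "expectation (rem \<epsilon> s t) \<ge> 0"
    by (rule Bochner_Integration.integral_nonneg) (rule rem_bounds[OF \<epsilon>])
  ultimately show ?thesis
    using step_expectation(2)[OF assms] by simp
qed

text \<open>The 8 collects 2 from the tangent bound for the damping factor and 6 from the mixed term
  of the remainder; 12 is 4 times the 3 of the Gaussian fourth moment.\<close>

lemma step_lower:
  assumes \<epsilon>: "\<epsilon> > 0" and st: "0 \<le> s" "s < t" "t \<le> T"
    and N: "integrable \<Omega> (N s)" "expectation (N s) \<le> m"
  shows "\<kappa> * (t - s) * (1 - 8 * \<epsilon> * m) - 12 * \<epsilon> * \<kappa>\<^sup>2 * (t - s)\<^sup>2 \<le> expectation (step \<epsilon> s t)"
proof -
  have s: "s \<in> {0..T}" using st by auto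
  let ?n = "\<kappa> * (t - s)"
  have n: "?n \<ge> 0" using \<kappa>_nonneg st by simp
  have "1 - 2 * \<epsilon> * m \<le> 1 - 2 * \<epsilon> * expectation (N s)"
    using N \<epsilon> by simp
  also have "\<dots> = expectation (\<lambda>\<omega>. 1 - 2 * \<epsilon> * N s \<omega>)"
    using N by (subst Bochner_Integration.integral_diff) (auto simp: prob_space)
  also have "\<dots> \<le> expectation (\<lambda>\<omega>. 1 / (1 + \<epsilon> * N s \<omega>)\<^sup>2)"
    using N by (intro integral_mono factor_integrable \<epsilon> s Bochner_Integration.integrable_diff
        integrable_const integrable_mult_right damping_factor)
  finally have 1: "(1 - 2 * \<epsilon> * m) * ?n \<le> expectation (\<lambda>\<omega>. 1 / (1 + \<epsilon> * N s \<omega>)\<^sup>2) * ?n"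
    using n by (intro mult_right_mono)
  note NN = noise_sq_expectation[OF st(1,2) N_adapted[OF s] N(1)]
  note M = noise_sq_moments[OF st(1,2)]
  have "expectation (rem \<epsilon> s t)
      \<le> expectation (\<lambda>\<omega>. 6 * \<epsilon> * (N s \<omega> * noise_sq s t \<omega>) + 4 * \<epsilon> * (noise_sq s t \<omega>)\<^sup>2)"
    by (intro integral_mono step_expectation[OF \<epsilon> st] Bochner_Integration.integrable_add
        integrable_mult_right NN M rem_bounds[OF \<epsilon>])
  also have "\<dots> = 6 * \<epsilon> * (expectation (N s) * ?n) + 4 * \<epsilon> * expectation (\<lambda>\<omega>. (noise_sq s t \<omega>)\<^sup>2)"
    using NN M by (subst Bochner_Integration.integral_add) auto
  also have "\<dots> \<le> 6 * \<epsilon> * (m * ?n) + 4 * \<epsilon> * (3 * \<kappa>\<^sup>2 * (t - s)\<^sup>2)"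
    using N \<epsilon> n M by (intro add_mono mult_left_mono mult_right_mono) auto
  finally have "expectation (rem \<epsilon> s t) \<le> 6 * \<epsilon> * (m * ?n) + 4 * \<epsilon> * (3 * \<kappa>\<^sup>2 * (t - s)\<^sup>2)" .
  with 1 show ?thesis
    unfolding step_expectation(2)[OF \<epsilon> st] by (simp add: algebra_simps)
qed

text \<open>The bound is uniform in \<open>n\<close>: the linear parts are controlled by
  orthogonality, the others by the sum of the squared noise increments, whose second moment stays
  bounded as the grid is refined.\<close>

lemma step_sum_L2:
  assumes \<epsilon>: "\<epsilon> > 0" and t: "0 < t" "t \<le> T"
  shows "expectation (\<lambda>\<omega>. (\<Sum>k<Suc n. step \<epsilon> (grid t n k) (grid t n (Suc k)) \<omega>)\<^sup>2)
    \<le> 8 * \<kappa> * t / \<epsilon> + 150 * \<kappa>\<^sup>2 * t\<^sup>2"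
proof -
  let ?\<Delta> = "t / real (Suc n)"
  note diff = grid_props(1)[OF t(1)] and grid_nonneg = grid_props(2)[OF t(1)]
    and grid_less = grid_props(3)[OF t(1)]
  have grid_le: "grid t n (Suc k) \<le> T" if "k < Suc n" for k
    using grid_props(4)[OF t(1) that] t by linarith
  have grid_0: "grid t n 0 = 0" and grid_last: "grid t n (Suc n) = t"
    by (simp_all add: grid_def del: of_nat_Suc)
  define A where "A \<omega> = (\<Sum>k<Suc n. lin \<epsilon> (grid t n k) (grid t n (Suc k)) \<omega>)" for \<omega>
  define R where "R \<omega> = (\<Sum>k<Suc n. noise_sq (grid t n k) (grid t n (Suc k)) \<omega>)" for \<omega>
  define S where "S \<omega> = (\<Sum>k<Suc n. step \<epsilon> (grid t n k) (grid t n (Suc k)) \<omega>)" for \<omega>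
  define Q where "Q \<omega> = (\<Sum>k<Suc n. (noise_sq (grid t n k) (grid t n (Suc k)) \<omega>)\<^sup>2)" for \<omega>
  have A: "integrable \<Omega> (\<lambda>\<omega>. (A \<omega>)\<^sup>2)" "expectation (\<lambda>\<omega>. (A \<omega>)\<^sup>2) \<le> \<kappa> * t / \<epsilon>"
    using lin_sum_L2[OF \<epsilon>, of "grid t n" "Suc n"] grid_nonneg grid_less grid_le grid_0 grid_last t
    unfolding A_def by simp_all
  note M = noise_sq_moments[OF grid_nonneg grid_less, unfolded diff]
  have Q: "integrable \<Omega> Q"
    unfolding Q_def[abs_def] by (intro Bochner_Integration.integrable_sum M)
  have "expectation Q = (\<Sum>k<Suc n. expectation (\<lambda>\<omega>. (noise_sq (grid t n k) (grid t n (Suc k)) \<omega>)\<^sup>2))"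
    unfolding Q_def[abs_def] by (intro Bochner_Integration.integral_sum M)
  also have "\<dots> \<le> (\<Sum>k<Suc n. 3 * \<kappa>\<^sup>2 * ?\<Delta>\<^sup>2)"
    by (intro sum_mono M)
  \<comment> \<open>The factor \<open>Suc n\<close> anticipates the Cauchy-Schwarz bound in
    \<open>RQ\<close>; together with the number of summands it turns the squared interval length
    into \<open>t^2\<close>.\<close>
  finally have EQ: "real (Suc n) * expectation Q \<le> 3 * \<kappa>\<^sup>2 * t\<^sup>2"
    by (simp add: power_divide power2_eq_square field_simps del: of_nat_Suc)
  have RQ: "(R \<omega>)\<^sup>2 \<le> real (Suc n) * Q \<omega>" for \<omega>
    using sum_squared_le_sum_of_squares[of "\<lambda>k. noise_sq (grid t n k) (grid t n (Suc k)) \<omega>" "{..<Suc n}"]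
    unfolding R_def Q_def by (simp add: mult.commute del: sum.lessThan_Suc of_nat_Suc)
  \<comment> \<open>By the triangle inequality: 1 for the damped quadratic term and 4 for the
    remainder.\<close>
  have SAR: "\<bar>S \<omega> - 2 * A \<omega>\<bar> \<le> 5 * R \<omega>" for \<omega>
  proof -
    have eq: "S \<omega> - 2 * A \<omega> = (\<Sum>k<Suc n. step \<epsilon> (grid t n k) (grid t n (Suc k)) \<omega> - 2 * lin \<epsilon> (grid t n k) (grid t n (Suc k)) \<omega>)"
      unfolding S_def A_def by (simp only: sum_subtractf sum_distrib_left)
    have "norm (S \<omega> - 2 * A \<omega>) \<le> (\<Sum>k<Suc n. 5 * noise_sq (grid t n k) (grid t n (Suc k)) \<omega>)"
      unfolding eq
    proof (intro sum_norm_le)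
      fix k
      let ?q = "noise_sq (grid t n k) (grid t n (Suc k)) \<omega>" and ?d = "1 / (1 + \<epsilon> * N (grid t n k) \<omega>)\<^sup>2"
      have "0 \<le> ?d * ?q"
        using damping_factor(1)[OF \<epsilon>] noise_sq_nonneg by (rule mult_nonneg_nonneg)
      then have lower: "0 \<le> ?q / (1 + \<epsilon> * N (grid t n k) \<omega>)\<^sup>2"
        by (simp only: times_divide_eq_left mult_1)
      have "?d * ?q \<le> 1 * ?q"
        using damping_factor(2)[OF \<epsilon>] noise_sq_nonneg by (rule mult_right_mono)
      then have upper: "?q / (1 + \<epsilon> * N (grid t n k) \<omega>)\<^sup>2 \<le> ?q"
        by (simp only: times_divide_eq_left mult_1)
      show "norm (step \<epsilon> (grid t n k) (grid t n (Suc k)) \<omega> - 2 * lin \<epsilon> (grid t n k) (grid t n (Suc k)) \<omega>) \<le> 5 * ?q"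
        using rem_bounds(1,2)[OF \<epsilon>, of "grid t n k" "grid t n (Suc k)" \<omega>] lower upper
        unfolding step_eq[OF \<epsilon>] real_norm_def by linarith
    qed
    then show ?thesis
      unfolding R_def sum_distrib_left real_norm_def .
  qed
  \<comment> \<open>Splitting \<open>S\<close> into \<open>2 * A\<close> and the rest doubles each
    square: 8 is twice 4, and 50 is twice 25.\<close>
  have bound: "(S \<omega>)\<^sup>2 \<le> 8 * (A \<omega>)\<^sup>2 + 50 * (real (Suc n) * Q \<omega>)" for \<omega>
  proof -
    have "(S \<omega> - 2 * A \<omega>)\<^sup>2 \<le> (5 * R \<omega>)\<^sup>2"
      using power_mono[OF SAR[of \<omega>] abs_ge_zero, of 2] by simp
    moreover have "(S \<omega>)\<^sup>2 \<le> 2 * (2 * A \<omega>)\<^sup>2 + 2 * (S \<omega> - 2 * A \<omega>)\<^sup>2"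
      using zero_le_power2[of "2 * A \<omega> - (S \<omega> - 2 * A \<omega>)"] by (simp add: power2_eq_square algebra_simps)
    ultimately show ?thesis
      using RQ[of \<omega>] by (simp add: power_mult_distrib del: of_nat_Suc)
  qed
  have int: "integrable \<Omega> (\<lambda>\<omega>. 8 * (A \<omega>)\<^sup>2 + 50 * (real (Suc n) * Q \<omega>))"
    by (intro Bochner_Integration.integrable_add integrable_mult_right A Q)
  have "expectation (\<lambda>\<omega>. (S \<omega>)\<^sup>2) \<le> expectation (\<lambda>\<omega>. 8 * (A \<omega>)\<^sup>2 + 50 * (real (Suc n) * Q \<omega>))"
    by (intro integral_mono' int bound) (rule order_trans[OF zero_le_power2 bound])
  also have "\<dots> = 8 * expectation (\<lambda>\<omega>. (A \<omega>)\<^sup>2) + 50 * (real (Suc n) * expectation Q)"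
    using A Q by (subst Bochner_Integration.integral_add) (auto simp del: of_nat_Suc)
  also have "\<dots> \<le> 8 * (\<kappa> * t / \<epsilon>) + 50 * (3 * \<kappa>\<^sup>2 * t\<^sup>2)"
    by (intro add_mono mult_left_mono A EQ) auto
  finally show ?thesis by (simp add: S_def)
qed

section \<open>The accumulated drift part and its vanishing expectation\<close>

definition drift_part :: "real \<Rightarrow> real \<Rightarrow> nat \<Rightarrow> 'a \<Rightarrow> real" where
  "drift_part \<epsilon> t n \<omega> = damp \<epsilon> (N t \<omega>) - damp \<epsilon> (N 0 \<omega>)
     - (\<Sum>k<Suc n. step \<epsilon> (grid t n k) (grid t n (Suc k)) \<omega>)"

lemma drift_part_tendsto:
  assumes \<epsilon>: "\<epsilon> > 0" and t: "0 < t" "t \<le> T"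
  shows "AE \<omega> in \<Omega>. (\<lambda>n. drift_part \<epsilon> t n \<omega>) \<longlonglongrightarrow> 0"
proof -
  have "AE \<omega> in \<Omega>. \<forall>j\<in>J. continuous_on {0..T} (\<lambda>t. X j t \<omega>)"
    by (intro AE_finite_allI finite_J X_cont)
  moreover have "AE \<omega> in \<Omega>. \<forall>j\<in>J. continuous_on {0..T} (\<lambda>t. f j t \<omega>)"
    by (intro AE_finite_allI finite_J f_cont)
  moreover have "AE \<omega> in \<Omega>. \<forall>j\<in>J. \<forall>t\<in>{0..T}. (\<lambda>s. f j s \<omega>) integrable_on {0..t} \<and>
        X j t \<omega> = X j 0 \<omega> + integral {0..t} (\<lambda>s. f j s \<omega>) + \<sigma> j * (B j t \<omega> - B j 0 \<omega>)"
    using sde unfolding solves_sde_def by (rule AE_finite_allI[OF finite_J])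
  ultimately show ?thesis
    using orthogonal
  proof eventually_elim
    case (elim \<omega>)
    \<comment> \<open>The noise is written as the increment of a path normalized at time 0, the form
      in which it enters the integrated equation.\<close>
    have noise: "noise s t \<omega> j = \<sigma> j * (B j t \<omega> - B j 0 \<omega>) - \<sigma> j * (B j s \<omega> - B j 0 \<omega>)" for s t j
      by (simp add: noise_def algebra_simps)
    show ?case
      unfolding drift_part_def step_def N_def noise
      by (rule orthogonal_drift_grid[where T=T and x="\<lambda>j t. X j t \<omega>" and f="\<lambda>j t. f j t \<omega>"
            and w="\<lambda>j t. \<sigma> j * (B j t \<omega> - B j 0 \<omega>)"])
        (use elim t \<epsilon> finite_J in blast)+
  qed
qed

text \<open>The drift part is the change \<open>d\<close> of the damped charge, bounded by
  \<open>1 / \<epsilon>\<close>, minus the noise sum \<open>S\<close>, whose second moment is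
  bounded uniformly in \<open>n\<close>.\<close>

lemma drift_part_L2:
  assumes \<epsilon>: "\<epsilon> > 0" and t: "0 < t" "t \<le> T"
  shows "drift_part \<epsilon> t n \<in> borel_measurable \<Omega>"
    "integrable \<Omega> (\<lambda>\<omega>. (drift_part \<epsilon> t n \<omega>)\<^sup>2)"
    "expectation (\<lambda>\<omega>. (drift_part \<epsilon> t n \<omega>)\<^sup>2) \<le> 2 / \<epsilon>\<^sup>2 + 2 * (8 * \<kappa> * t / \<epsilon> + 150 * \<kappa>\<^sup>2 * t\<^sup>2)"
proof -
  have N_meas: "(\<lambda>\<omega>. damp \<epsilon> (N s \<omega>)) \<in> borel_measurable \<Omega>" if "s \<in> {0..T}" for s
    by (intro measurable_compose[OF _ damp_measurable] N_measurable that)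
  have step_meas: "step \<epsilon> (grid t n k) (grid t n (Suc k)) \<in> borel_measurable \<Omega>" if "k < Suc n" for k
    using grid_props[OF t(1), where n=n and k=k] that t by (intro step_measurable) auto
  define S where "S \<omega> = (\<Sum>k<Suc n. step \<epsilon> (grid t n k) (grid t n (Suc k)) \<omega>)" for \<omega>
  have S_meas: "S \<in> borel_measurable \<Omega>"
    unfolding S_def[abs_def] by (intro borel_measurable_sum step_meas) simp
  define d where "d \<omega> = damp \<epsilon> (N t \<omega>) - damp \<epsilon> (N 0 \<omega>)" for \<omega>
  have d_meas: "d \<in> borel_measurable \<Omega>"
    unfolding d_def[abs_def] using t by (intro borel_measurable_diff N_meas) auto
  have dp: "drift_part \<epsilon> t n \<omega> = d \<omega> - S \<omega>" for \<omega>
    by (simp only: drift_part_def d_def S_def)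
  have d_bound: "\<bar>d \<omega>\<bar> \<le> 1 / \<epsilon>" for \<omega>
    using damp_bounds(1,3)[OF \<epsilon> N_nonneg[of t \<omega>]] damp_bounds(1,3)[OF \<epsilon> N_nonneg[of 0 \<omega>]]
    unfolding d_def by linarith
  \<comment> \<open>This crude bound grows with \<open>n\<close> and serves only for integrability;
    the uniform estimate comes from \<open>step_sum_L2\<close>.\<close>
  have S_bound: "\<bar>S \<omega>\<bar> \<le> real (Suc n) * (1 / \<epsilon>)" for \<omega>
  proof -
    have "norm (S \<omega>) \<le> (\<Sum>k<Suc n. 1 / \<epsilon>)"
      unfolding S_def by (intro sum_norm_le) (use step_bound[OF \<epsilon>] in simp)
    then show ?thesis by (simp del: sum.lessThan_Suc of_nat_Suc)
  qed
  show "drift_part \<epsilon> t n \<in> borel_measurable \<Omega>"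
    unfolding dp by (intro borel_measurable_diff d_meas S_meas)
  have S2: "integrable \<Omega> (\<lambda>\<omega>. (S \<omega>)\<^sup>2)"
  proof (rule integrable_const_bound)
    show "AE \<omega> in \<Omega>. norm ((S \<omega>)\<^sup>2) \<le> (real (Suc n) * (1 / \<epsilon>))\<^sup>2"
      using power_mono[OF S_bound abs_ge_zero, of _ 2] by (intro AE_I2) simp
  qed (intro borel_measurable_power S_meas)
  have ptw: "(d \<omega> - S \<omega>)\<^sup>2 \<le> 2 / \<epsilon>\<^sup>2 + 2 * (S \<omega>)\<^sup>2" for \<omega>
  proof -
    have "(d \<omega>)\<^sup>2 \<le> 1 / \<epsilon>\<^sup>2"
      using power_mono[OF d_bound abs_ge_zero, of \<omega> 2] by (simp add: power_divide)
    moreover have "(d \<omega> - S \<omega>)\<^sup>2 \<le> 2 * (d \<omega>)\<^sup>2 + 2 * (S \<omega>)\<^sup>2"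
      using zero_le_power2[of "d \<omega> + S \<omega>"] by (simp add: power2_eq_square algebra_simps)
    ultimately show ?thesis by simp
  qed
  have int: "integrable \<Omega> (\<lambda>\<omega>. 2 / \<epsilon>\<^sup>2 + 2 * (S \<omega>)\<^sup>2)"
    by (intro Bochner_Integration.integrable_add integrable_const integrable_mult_right S2)
  show int2: "integrable \<Omega> (\<lambda>\<omega>. (drift_part \<epsilon> t n \<omega>)\<^sup>2)"
    unfolding dp
    by (rule Bochner_Integration.integrable_bound[OF int])
      (intro borel_measurable_power borel_measurable_diff d_meas S_meas,
       intro AE_I2, use order_trans[OF ptw abs_ge_self] in simp)
  have "expectation (\<lambda>\<omega>. (drift_part \<epsilon> t n \<omega>)\<^sup>2) \<le> expectation (\<lambda>\<omega>. 2 / \<epsilon>\<^sup>2 + 2 * (S \<omega>)\<^sup>2)"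
    using int2 unfolding dp by (intro integral_mono int ptw)
  also have "\<dots> = 2 / \<epsilon>\<^sup>2 + 2 * expectation (\<lambda>\<omega>. (S \<omega>)\<^sup>2)"
    using S2 by (subst Bochner_Integration.integral_add) (auto simp: prob_space)
  also have "\<dots> \<le> 2 / \<epsilon>\<^sup>2 + 2 * (8 * \<kappa> * t / \<epsilon> + 150 * \<kappa>\<^sup>2 * t\<^sup>2)"
    using step_sum_L2[OF \<epsilon> t, of n] unfolding S_def by (intro add_left_mono mult_left_mono) auto
  finally show "expectation (\<lambda>\<omega>. (drift_part \<epsilon> t n \<omega>)\<^sup>2)
    \<le> 2 / \<epsilon>\<^sup>2 + 2 * (8 * \<kappa> * t / \<epsilon> + 150 * \<kappa>\<^sup>2 * t\<^sup>2)" .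
qed

lemma drift_part_expectation:
  assumes \<epsilon>: "\<epsilon> > 0" and t: "0 < t" "t \<le> T"
  shows "(\<lambda>n. expectation (drift_part \<epsilon> t n)) \<longlonglongrightarrow> 0"
    "expectation (drift_part \<epsilon> t n) = expectation (\<lambda>\<omega>. damp \<epsilon> (N t \<omega>)) - expectation (\<lambda>\<omega>. damp \<epsilon> (N 0 \<omega>))
       - (\<Sum>k<Suc n. expectation (step \<epsilon> (grid t n k) (grid t n (Suc k))))"
proof -
  show "(\<lambda>n. expectation (drift_part \<epsilon> t n)) \<longlonglongrightarrow> 0"
    by (rule expectation_tendsto_zero_if_L2_bounded[OF drift_part_L2(1)[OF assms]
          drift_part_tendsto[OF assms] drift_part_L2(2,3)[OF assms]])
  have d: "integrable \<Omega> (\<lambda>\<omega>. damp \<epsilon> (N s \<omega>))" if "s \<in> {0..T}" for s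
    by (intro damp_integrable \<epsilon> N_measurable that N_nonneg)
  have s: "integrable \<Omega> (step \<epsilon> (grid t n k) (grid t n (Suc k)))" if "k < Suc n" for k
    using grid_props[OF t(1), where n=n and k=k] that t by (intro step_integrable \<epsilon>) auto
  have "expectation (drift_part \<epsilon> t n) = expectation (\<lambda>\<omega>. damp \<epsilon> (N t \<omega>) - damp \<epsilon> (N 0 \<omega>))
      - expectation (\<lambda>\<omega>. \<Sum>k<Suc n. step \<epsilon> (grid t n k) (grid t n (Suc k)) \<omega>)"
    unfolding drift_part_def[abs_def] using t
    by (intro Bochner_Integration.integral_diff Bochner_Integration.integrable_diff d
        Bochner_Integration.integrable_sum s) auto
  also have "\<dots> = expectation (\<lambda>\<omega>. damp \<epsilon> (N t \<omega>)) - expectation (\<lambda>\<omega>. damp \<epsilon> (N 0 \<omega>))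
      - (\<Sum>k<Suc n. expectation (step \<epsilon> (grid t n k) (grid t n (Suc k))))"
    using t by (intro arg_cong2[where f="(-)"] Bochner_Integration.integral_diff
        Bochner_Integration.integral_sum d s) auto
  finally show "expectation (drift_part \<epsilon> t n) = expectation (\<lambda>\<omega>. damp \<epsilon> (N t \<omega>)) - expectation (\<lambda>\<omega>. damp \<epsilon> (N 0 \<omega>))
       - (\<Sum>k<Suc n. expectation (step \<epsilon> (grid t n k) (grid t n (Suc k))))" .
qed

section \<open>Two-sided bounds for the expected charge and removal of the damping\<close>

lemma N_0: "AE \<omega> in \<Omega>. N 0 \<omega> = sqsum J x0"
proof -
  have "AE \<omega> in \<Omega>. \<forall>j\<in>J. X j 0 \<omega> = x0 j"
    using X_0 by (intro AE_finite_allI finite_J)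
  then show ?thesis
    by eventually_elim (simp add: N_def)
qed

lemma expectation_N_0:
  assumes "0 \<le> T"
  shows "integrable \<Omega> (N 0)" "expectation (N 0) = sqsum J x0"
    "expectation (\<lambda>\<omega>. damp \<epsilon> (N 0 \<omega>)) = damp \<epsilon> (sqsum J x0)"
proof -
  have m: "N 0 \<in> borel_measurable \<Omega>" using assms by (intro N_measurable) auto
  show "integrable \<Omega> (N 0)"
    using integrable_cong_AE[OF m borel_measurable_const N_0] by simp
  show "expectation (N 0) = sqsum J x0"
    using integral_cong_AE[OF m borel_measurable_const N_0] by (simp add: prob_space)
  have "AE \<omega> in \<Omega>. damp \<epsilon> (N 0 \<omega>) = damp \<epsilon> (sqsum J x0)"
    using N_0 by eventually_elim simp
  from integral_cong_AE[OF measurable_compose[OF m damp_measurable] borel_measurable_const this]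
  show "expectation (\<lambda>\<omega>. damp \<epsilon> (N 0 \<omega>)) = damp \<epsilon> (sqsum J x0)"
    by (simp add: prob_space)
qed

text \<open>Summing \<open>step_upper\<close> over the grid bounds a number independent of
  \<open>n\<close> by the expected drift part, which tends to 0.\<close>

lemma damp_N_upper:
  assumes \<epsilon>: "\<epsilon> > 0" and t: "0 < t" "t \<le> T"
  shows "expectation (\<lambda>\<omega>. damp \<epsilon> (N t \<omega>)) \<le> damp \<epsilon> (sqsum J x0) + \<kappa> * t"
proof -
  have le: "expectation (\<lambda>\<omega>. damp \<epsilon> (N t \<omega>)) - damp \<epsilon> (sqsum J x0) - \<kappa> * t
      \<le> expectation (drift_part \<epsilon> t n)" for n
  proof -
    have "(\<Sum>k<Suc n. expectation (step \<epsilon> (grid t n k) (grid t n (Suc k))))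
        \<le> (\<Sum>k<Suc n. \<kappa> * (t / real (Suc n)))"
    proof (rule sum_mono)
      fix k assume "k \<in> {..<Suc n}"
      then show "expectation (step \<epsilon> (grid t n k) (grid t n (Suc k))) \<le> \<kappa> * (t / real (Suc n))"
        using step_upper[OF \<epsilon>, of "grid t n k" "grid t n (Suc k)"] grid_props[OF t(1), where n=n and k=k] t
        by (simp del: of_nat_Suc)
    qed
    also have "\<dots> = \<kappa> * t" by (simp del: of_nat_Suc sum.lessThan_Suc)
    finally show ?thesis
      unfolding drift_part_expectation(2)[OF assms] using expectation_N_0(3)[of \<epsilon>] t by simp
  qed
  have "expectation (\<lambda>\<omega>. damp \<epsilon> (N t \<omega>)) - damp \<epsilon> (sqsum J x0) - \<kappa> * t \<le> 0"
    by (rule LIMSEQ_le_const[OF drift_part_expectation(1)[OF assms]]) (use le in auto)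
  then show ?thesis by simp
qed

text \<open>Monotone convergence along \<open>\<epsilon> = 1 / (n + 1)\<close>: the bound on the
  damped expectations is free of \<epsilon>, so the limit is integrable and inherits it.\<close>

lemma N_upper:
  assumes t: "0 \<le> t" "t \<le> T"
  shows "integrable \<Omega> (N t)" "expectation (N t) \<le> sqsum J x0 + \<kappa> * t"
proof -
  have "integrable \<Omega> (N t) \<and> expectation (N t) \<le> sqsum J x0 + \<kappa> * t"
  proof (cases "t = 0")
    case True
    then show ?thesis using expectation_N_0 t by simp
  next
    case False
    then have t0: "0 < t" using t by simp
    define u where "u n \<omega> = damp (1 / real (Suc n)) (N t \<omega>)" for n \<omega>
    have m: "N t \<in> borel_measurable \<Omega>" using t by (intro N_measurable) auto
    have u: "integrable \<Omega> (u n)" for n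
      unfolding u_def[abs_def] by (intro damp_integrable m N_nonneg) simp
    have mono: "u n \<omega> \<le> u k \<omega>" if "n \<le> k" for n k \<omega>
      unfolding u_def using that by (intro damp_antimono N_nonneg) (auto simp: field_simps)
    have le: "expectation (u n) \<le> sqsum J x0 + \<kappa> * t" for n
    proof -
      have "damp (1 / real (Suc n)) (sqsum J x0) \<le> sqsum J x0"
        by (intro damp_bounds sum_nonneg) auto
      then show ?thesis
        using damp_N_upper[OF _ t0 t(2), of "1 / real (Suc n)"] unfolding u_def by simp
    qed
    have "incseq (\<lambda>n. expectation (u n))"
      unfolding incseq_def using mono by (auto intro!: integral_mono u)
    then obtain L where L: "(\<lambda>n. expectation (u n)) \<longlonglongrightarrow> L"
      using incseq_convergent[of "\<lambda>n. expectation (u n)"] le by blast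
    have "L \<le> sqsum J x0 + \<kappa> * t"
      by (rule LIMSEQ_le_const2[OF L]) (use le in auto)
    moreover have mono': "AE \<omega> in \<Omega>. mono (\<lambda>n. u n \<omega>)"
      using mono by (auto simp: mono_def)
    have pos': "AE \<omega> in \<Omega>. 0 \<le> u n \<omega>" for n
      unfolding u_def by (intro AE_I2 damp_bounds(1) N_nonneg) simp
    have lim': "AE \<omega> in \<Omega>. (\<lambda>n. u n \<omega>) \<longlonglongrightarrow> N t \<omega>"
      unfolding u_def by (intro AE_I2 damp_tendsto N_nonneg)
    note integral_monotone_convergence_nonneg[OF u mono' pos' lim' L m]
    ultimately show ?thesis by simp
  qed
  then show "integrable \<Omega> (N t)" "expectation (N t) \<le> sqsum J x0 + \<kappa> * t" by auto
qed

text \<open>By \<open>N_upper\<close>, \<open>m\<close> dominates the expected charge at every grid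
  point, so \<open>step_lower\<close> applies with the same constant throughout. The three terms
  multiplied by \<epsilon> come from damping the initial charge, from this \<open>m\<close>, and
  from the fourth moments.\<close>

lemma N_lower:
  assumes \<epsilon>: "\<epsilon> > 0" and t: "0 < t" "t \<le> T"
  defines "m \<equiv> sqsum J x0 + \<kappa> * T"
  shows "sqsum J x0 + \<kappa> * t - \<epsilon> * ((sqsum J x0)\<^sup>2 + 8 * \<kappa> * t * m + 12 * \<kappa>\<^sup>2 * t\<^sup>2) \<le> expectation (N t)"
proof -
  let ?l = "\<kappa> * t * (1 - 8 * \<epsilon> * m) - 12 * \<epsilon> * \<kappa>\<^sup>2 * t\<^sup>2"
  have ge: "expectation (drift_part \<epsilon> t n)
      \<le> expectation (\<lambda>\<omega>. damp \<epsilon> (N t \<omega>)) - damp \<epsilon> (sqsum J x0) - ?l" for n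
  proof -
    let ?\<Delta> = "t / real (Suc n)"
    have "(\<Sum>k<Suc n. \<kappa> * ?\<Delta> * (1 - 8 * \<epsilon> * m) - 12 * \<epsilon> * \<kappa>\<^sup>2 * ?\<Delta>\<^sup>2)
        \<le> (\<Sum>k<Suc n. expectation (step \<epsilon> (grid t n k) (grid t n (Suc k))))"
    proof (rule sum_mono)
      fix k assume k: "k \<in> {..<Suc n}"
      let ?s = "grid t n k"
      note g = grid_props[OF t(1), where n=n and k=k]
      have s: "0 \<le> ?s" "?s \<le> T" using g k t by auto
      have "\<kappa> * ?s \<le> \<kappa> * T" using s \<kappa>_nonneg by (intro mult_left_mono)
      then have "expectation (N ?s) \<le> m"
        using N_upper(2)[OF s] unfolding m_def by linarith
      then show "\<kappa> * ?\<Delta> * (1 - 8 * \<epsilon> * m) - 12 * \<epsilon> * \<kappa>\<^sup>2 * ?\<Delta>\<^sup>2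
          \<le> expectation (step \<epsilon> ?s (grid t n (Suc k)))"
        using step_lower[OF \<epsilon> g(2,3) _ N_upper(1)[OF s], of m] g k t by auto
    qed
    moreover have "(\<Sum>k<Suc n. \<kappa> * ?\<Delta> * (1 - 8 * \<epsilon> * m) - 12 * \<epsilon> * \<kappa>\<^sup>2 * ?\<Delta>\<^sup>2)
        = real (Suc n) * (\<kappa> * ?\<Delta> * (1 - 8 * \<epsilon> * m)) - real (Suc n) * (12 * \<epsilon> * \<kappa>\<^sup>2 * ?\<Delta>\<^sup>2)"
      by (simp add: right_diff_distrib del: of_nat_Suc sum.lessThan_Suc)
    moreover have "real (Suc n) * (\<kappa> * ?\<Delta> * (1 - 8 * \<epsilon> * m)) = \<kappa> * t * (1 - 8 * \<epsilon> * m)"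
      by (simp del: of_nat_Suc)
    \<comment> \<open>The left side is of order \<open>1 / Suc n\<close>; the bound by its value at
      \<open>n = 0\<close> suffices because the factor \<epsilon> is sent to 0 later.\<close>
    moreover have "real (Suc n) * (12 * \<epsilon> * \<kappa>\<^sup>2 * ?\<Delta>\<^sup>2) \<le> 12 * \<epsilon> * \<kappa>\<^sup>2 * t\<^sup>2"
    proof -
      have "real (Suc n) * ?\<Delta>\<^sup>2 = t\<^sup>2 / real (Suc n)"
        by (simp add: power2_eq_square del: of_nat_Suc)
      also have "\<dots> \<le> t\<^sup>2 / 1"
        by (intro divide_left_mono) auto
      finally have "12 * \<epsilon> * \<kappa>\<^sup>2 * (real (Suc n) * ?\<Delta>\<^sup>2) \<le> 12 * \<epsilon> * \<kappa>\<^sup>2 * t\<^sup>2"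
        using \<epsilon> by (intro mult_left_mono) auto
      then show ?thesis by (simp only: mult.left_commute mult.assoc)
    qed
    ultimately have "?l \<le> (\<Sum>k<Suc n. expectation (step \<epsilon> (grid t n k) (grid t n (Suc k))))"
      by linarith
    then show ?thesis
      unfolding drift_part_expectation(2)[OF \<epsilon> t] using expectation_N_0(3)[of \<epsilon>] t by simp
  qed
  have "0 \<le> expectation (\<lambda>\<omega>. damp \<epsilon> (N t \<omega>)) - damp \<epsilon> (sqsum J x0) - ?l"
    by (rule LIMSEQ_le_const2[OF drift_part_expectation(1)[OF \<epsilon> t]]) (use ge in auto)
  moreover have "expectation (\<lambda>\<omega>. damp \<epsilon> (N t \<omega>)) \<le> expectation (N t)"
    using t by (intro integral_mono damp_integrable N_upper(1) damp_bounds(2) \<epsilon> N_measurable N_nonneg) auto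
  moreover have "sqsum J x0 - \<epsilon> * (sqsum J x0)\<^sup>2 \<le> damp \<epsilon> (sqsum J x0)"
    by (intro damp_bounds \<epsilon> sum_nonneg) simp
  ultimately show ?thesis by (simp add: algebra_simps)
qed

lemma expectation_N:
  assumes t: "0 \<le> t" "t \<le> T"
  shows "integrable \<Omega> (N t)" "expectation (N t) = expectation (N 0) + \<kappa> * t"
proof -
  show "integrable \<Omega> (N t)" by (rule N_upper(1)[OF t])
  show "expectation (N t) = expectation (N 0) + \<kappa> * t"
  proof (cases "t = 0")
    case False
    then have t0: "0 < t" using t by simp
    \<comment> \<open>The coefficient of \<epsilon> in \<open>N_lower\<close>, so that
      \<open>\<epsilon> = 1 / (n + 1)\<close> turns the lower bound into the upper one in the
      limit.\<close>
    define K where "K = (sqsum J x0)\<^sup>2 + 8 * \<kappa> * t * (sqsum J x0 + \<kappa> * T) + 12 * \<kappa>\<^sup>2 * t\<^sup>2"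
    have lim: "(\<lambda>n. sqsum J x0 + \<kappa> * t - 1 / real (Suc n) * K) \<longlonglongrightarrow> sqsum J x0 + \<kappa> * t - 0 * K"
      by (intro tendsto_intros lim_inverse_n'[THEN LIMSEQ_Suc])
    have "sqsum J x0 + \<kappa> * t - 1 / real (Suc n) * K \<le> expectation (N t)" for n
      unfolding K_def by (rule N_lower[OF _ t0 t(2)]) simp
    then have "sqsum J x0 + \<kappa> * t - 0 * K \<le> expectation (N t)"
      by (intro LIMSEQ_le_const2[OF lim]) blast
    then show ?thesis
      using N_upper(2)[OF t] expectation_N_0(2) t by simp
  qed simp
qed

end

section \<open>The semi-discrete system\<close>

text \<open>A component is the tuple followed by a projection. This passes from independence of the
  joint increment to that of a single one.\<close>

lemma sets_vimage_algebra_component: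
  assumes "i \<in> I" and maps: "\<And>i. i \<in> I \<Longrightarrow> g i \<in> X \<rightarrow> space N"
  shows "sets (vimage_algebra X (g i) N)
    \<subseteq> sets (vimage_algebra X (\<lambda>\<omega>. \<lambda>i\<in>I. g i \<omega>) (PiM I (\<lambda>_. N)))"
proof (rule sets_image_in_sets)
  let ?V = "vimage_algebra X (\<lambda>\<omega>. \<lambda>i\<in>I. g i \<omega>) (PiM I (\<lambda>_. N))"
  have "(\<lambda>\<omega>. \<lambda>i\<in>I. g i \<omega>) \<in> measurable ?V (PiM I (\<lambda>_. N))"
    using maps by (intro measurable_vimage_algebra1) (auto simp: space_PiM Pi_iff)
  from measurable_compose[OF this measurable_component_singleton[OF assms(1)]]
  show "g i \<in> measurable ?V N"
    using assms by simp
qed simp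

text \<open>Self-adjointness of a symmetric matrix; it makes the Laplacian terms of the two drifts
  cancel against each other.\<close>

lemma mat_vec_symmetric:
  assumes "\<And>i j. A i j = A j i"
  shows "(\<Sum>i\<in>{1..<M}. p i * mat_vec M A q i) = (\<Sum>i\<in>{1..<M}. q i * mat_vec M A p i)"
proof -
  have "(\<Sum>i\<in>{1..<M}. p i * mat_vec M A q i) = (\<Sum>i\<in>{1..<M}. \<Sum>j\<in>{1..<M}. p i * (A i j * q j))"
    by (simp add: mat_vec_def sum_distrib_left)
  also have "\<dots> = (\<Sum>j\<in>{1..<M}. \<Sum>i\<in>{1..<M}. p i * (A i j * q j))"
    by (rule sum.swap)
  also have "\<dots> = (\<Sum>j\<in>{1..<M}. q j * mat_vec M A p j)"
    unfolding mat_vec_def sum_distrib_left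
    by (intro sum.cong refl) (use assms in \<open>simp add: mult.left_commute mult.commute\<close>)
  finally show ?thesis .
qed

lemma lap_matrix_symmetric: "lap_matrix h i j = lap_matrix h j i"
  by (auto simp: lap_matrix_def)

lemma sum_Times_bool:
  fixes g :: "'a \<times> bool \<Rightarrow> real"
  shows "(\<Sum>j\<in>I \<times> UNIV. g j) = (\<Sum>i\<in>I. g (i, True) + g (i, False))"
  by (simp add: sum.cartesian_product' UNIV_bool add.commute)

lemma norm_h_sq:
  fixes f :: "nat \<Rightarrow> real"
  assumes "h \<ge> 0"
  shows "(norm_h h M f)\<^sup>2 = h * (\<Sum>i\<in>{1..<M}. (f i)\<^sup>2)"
proof -
  have "inner_h h M f f = h * (\<Sum>i\<in>{1..<M}. (f i)\<^sup>2)"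
    by (simp add: inner_h_def power2_eq_square)
  then show ?thesis
    using assms by (simp add: norm_h_def sum_nonneg)
qed

text \<open>\<open>P\<close> and \<open>Q\<close> together form a vector as in
  \<open>orthogonal_drift_sde\<close>, with \<open>U\<close> entering their drift as a continuous
  multiplier. The charge is \<open>h\<close> times the squared norm of this vector.\<close>

lemma semidiscrete_KGS_expectation:
  fixes \<Omega> :: "'a measure" and P Q U V :: "real \<Rightarrow> 'a \<Rightarrow> nat \<Rightarrow> real"
    and B :: "nat \<Rightarrow> real \<Rightarrow> 'a \<Rightarrow> real"
  assumes prob: "prob_space \<Omega>"
    and filtr: "filtration (space \<Omega>) F" and sub: "\<And>t. subalgebra \<Omega> (F t)"
    and wiener: "indep_wiener_processes \<Omega> F {0, 1, 2} B"
    and T: "T > 0" and h: "h \<ge> 0"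
    and sol: "semidiscrete_KGS_solution \<Omega> F T h M C1 C2 \<eta>1 \<eta>2 B p0 q0 u0 v0 P Q U V"
    and t: "t \<in> {0..T}"
  shows "integrable \<Omega> (\<lambda>\<omega>. charge h M (P t \<omega>) (Q t \<omega>))"
    "prob_space.expectation \<Omega> (\<lambda>\<omega>. charge h M (P t \<omega>) (Q t \<omega>)) =
      prob_space.expectation \<Omega> (\<lambda>\<omega>. charge h M (P 0 \<omega>) (Q 0 \<omega>)) + 2 * C1\<^sup>2 * (norm_h h M \<eta>1)\<^sup>2 * t"
proof -
  interpret prob_space \<Omega> by (rule prob)
  \<comment> \<open>The flag is \<open>True\<close> for the components of \<open>P\<close> and
    \<open>False\<close> for those of \<open>Q\<close>.\<close>
  define J :: "(nat \<times> bool) set" where "J = {1..<M} \<times> UNIV"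
  define X where "X j t \<omega> = (if snd j then P t \<omega> (fst j) else Q t \<omega> (fst j))" for j t \<omega>
  define f where "f j t \<omega> = (if snd j
      then - (mat_vec M (lap_matrix h) (Q t \<omega>) (fst j) + U t \<omega> (fst j) * Q t \<omega> (fst j))
      else mat_vec M (lap_matrix h) (P t \<omega>) (fst j) + U t \<omega> (fst j) * P t \<omega> (fst j))" for j t \<omega>
  define \<sigma> where "\<sigma> j = (if snd j then C1 * \<eta>1 (fst j) else - (C1 * \<eta>1 (fst j)))" for j :: "nat \<times> bool"
  \<comment> \<open>All components of \<open>P\<close> share the driver \<open>B 1\<close>, those of
    \<open>Q\<close> share \<open>B 0\<close>.\<close>
  define c :: "nat \<times> bool \<Rightarrow> nat" where "c j = (if snd j then 1 else 0)" for j
  define W where "W j = B (c j)" for j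
  define x0 where "x0 j = (if snd j then p0 (fst j) else q0 (fst j))" for j
  have wiener_B: "wiener_process \<Omega> (B i)" "adapted F {0..} (B i)" if "i \<in> {0, 1, 2}" for i
    using wiener that unfolding indep_wiener_processes_def by blast+
  have indep_B: "indep_set (sets (F s)) (sets (vimage_algebra (space \<Omega>)
      (\<lambda>\<omega>. \<lambda>i\<in>{0, 1, 2}. B i t \<omega> - B i s \<omega>) (PiM {0, 1, 2} (\<lambda>_. borel))))"
    if "0 \<le> s" "s \<le> t" for s t
    using wiener that unfolding indep_wiener_processes_def by blast
  have c: "c j \<in> {0, 1, 2}" for j by (simp add: c_def)
  have sol_i: "continuous_adapted \<Omega> F T (\<lambda>t \<omega>. P t \<omega> i)" "continuous_adapted \<Omega> F T (\<lambda>t \<omega>. Q t \<omega> i)"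
    "continuous_adapted \<Omega> F T (\<lambda>t \<omega>. U t \<omega> i)"
    "AE \<omega> in \<Omega>. P 0 \<omega> i = p0 i \<and> Q 0 \<omega> i = q0 i \<and> U 0 \<omega> i = u0 i \<and> V 0 \<omega> i = v0 i"
    "solves_sde \<Omega> T (\<lambda>t \<omega>. Q t \<omega> i)
          (\<lambda>t \<omega>. mat_vec M (lap_matrix h) (P t \<omega>) i + U t \<omega> i * P t \<omega> i) (- (C1 * \<eta>1 i)) (B 0)"
    "solves_sde \<Omega> T (\<lambda>t \<omega>. P t \<omega> i)
          (\<lambda>t \<omega>. - (mat_vec M (lap_matrix h) (Q t \<omega>) i + U t \<omega> i * Q t \<omega> i)) (C1 * \<eta>1 i) (B 1)"
    if "i \<in> {1..<M}" for i
    using sol that unfolding semidiscrete_KGS_solution_def by blast+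
  have cont: "AE \<omega> in \<Omega>. \<forall>i\<in>{1..<M}. continuous_on {0..T} (\<lambda>t. P t \<omega> i)"
    "AE \<omega> in \<Omega>. \<forall>i\<in>{1..<M}. continuous_on {0..T} (\<lambda>t. Q t \<omega> i)"
    "AE \<omega> in \<Omega>. \<forall>i\<in>{1..<M}. continuous_on {0..T} (\<lambda>t. U t \<omega> i)"
    using sol_i(1-3) unfolding continuous_adapted_def
    by (intro AE_finite_allI finite_atLeastLessThan; blast)+
  interpret orthogonal_drift_sde \<Omega> F J X f \<sigma> W x0 T
  proof
    show "finite J" by (simp add: J_def)
    show "subalgebra \<Omega> (F t)" for t by (rule sub)
    show "sets (F s) \<subseteq> sets (F t)" if "s \<le> t" for s t
      using filtration.sets_F_mono[OF filtr that] .
    show "X j t \<in> borel_measurable (F t)" if "j \<in> J" "t \<in> {0..T}" for j t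
      using sol_i(1,2)[of "fst j"] that
      by (cases "snd j") (auto simp: J_def X_def[abs_def] continuous_adapted_def adapted_def)
    show "AE \<omega> in \<Omega>. continuous_on {0..T} (\<lambda>t. X j t \<omega>)" if "j \<in> J" for j
      using sol_i(1,2)[of "fst j"] that
      by (cases "snd j") (auto simp: J_def X_def continuous_adapted_def)
    show "AE \<omega> in \<Omega>. continuous_on {0..T} (\<lambda>t. f j t \<omega>)" if "j \<in> J" for j
      using cont
    proof eventually_elim
      case (elim \<omega>)
      have "fst j \<in> {1..<M}" using that by (auto simp: J_def)
      then show ?case
        using elim unfolding f_def mat_vec_def
        by (cases "snd j") (auto intro!: continuous_intros)
    qed
    show "AE \<omega> in \<Omega>. \<forall>t\<in>{0..T}. (\<Sum>j\<in>J. X j t \<omega> * f j t \<omega>) = 0"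
    proof (intro AE_I2 ballI)
      fix \<omega> t
      \<comment> \<open>At each grid point the products of \<open>U\<close>, \<open>P\<close> and
        \<open>Q\<close> cancel; the Laplacian terms cancel only after summation, by
        symmetry.\<close>
      have "(\<Sum>j\<in>J. X j t \<omega> * f j t \<omega>)
          = (\<Sum>i\<in>{1..<M}. Q t \<omega> i * mat_vec M (lap_matrix h) (P t \<omega>) i
              - P t \<omega> i * mat_vec M (lap_matrix h) (Q t \<omega>) i)"
        unfolding J_def sum_Times_bool
        by (intro sum.cong refl) (simp add: X_def f_def algebra_simps)
      also have "\<dots> = 0"
        using mat_vec_symmetric[OF lap_matrix_symmetric[of h], where M=M and p="Q t \<omega>" and q="P t \<omega>"]
        by (simp add: sum_subtractf)
      finally show "(\<Sum>j\<in>J. X j t \<omega> * f j t \<omega>) = 0" .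
    qed
    show "solves_sde \<Omega> T (X j) (f j) (\<sigma> j) (W j)" if "j \<in> J" for j
      using sol_i(5,6)[of "fst j"] that
      by (cases "snd j") (auto simp: J_def X_def[abs_def] f_def[abs_def] \<sigma>_def W_def c_def)
    show "AE \<omega> in \<Omega>. X j 0 \<omega> = x0 j" if "j \<in> J" for j
      using sol_i(4)[of "fst j"] that
      by (cases "snd j") (auto simp: J_def X_def x0_def)
    show "W j t \<in> borel_measurable (F t)" if "0 \<le> t" for j t
      using wiener_B(2)[OF c[of j]] that by (simp add: W_def adapted_def)
    show "distributed \<Omega> lborel (\<lambda>\<omega>. W j t \<omega> - W j s \<omega>) (normal_density 0 (sqrt (t - s)))"
      if "0 \<le> s" "s < t" for j s t
      using wiener_B(1)[OF c[of j]] that by (simp add: W_def wiener_process_def)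
    show "indep_set (sets (F s)) (sets (vimage_algebra (space \<Omega>) (\<lambda>\<omega>. W j t \<omega> - W j s \<omega>) borel))"
      if "0 \<le> s" "s \<le> t" for j s t
      unfolding W_def
      by (rule indep_set_mono[OF indep_B[OF that] subset_refl sets_vimage_algebra_component[OF c]])
        simp
  qed
  have charge: "charge h M (P s \<omega>) (Q s \<omega>) = h * N s \<omega>" for s \<omega>
    unfolding charge_def norm_h_sq[OF h] N_def unfolding J_def sum_Times_bool
    by (simp add: X_def sum.distrib distrib_left)
  \<comment> \<open>The factor 2 arises because \<open>P\<close> and \<open>Q\<close> carry noise of
    the same squared intensity.\<close>
  have "\<kappa> = 2 * C1\<^sup>2 * (\<Sum>i\<in>{1..<M}. (\<eta>1 i)\<^sup>2)"
    unfolding \<kappa>_def unfolding J_def sum_Times_bool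
    by (simp add: \<sigma>_def power_mult_distrib sum_distrib_left mult.assoc)
  then have \<kappa>: "h * \<kappa> = 2 * C1\<^sup>2 * (norm_h h M \<eta>1)\<^sup>2"
    by (simp add: norm_h_sq h)
  have t': "0 \<le> t" "t \<le> T" using t by auto
  show "integrable \<Omega> (\<lambda>\<omega>. charge h M (P t \<omega>) (Q t \<omega>))"
    unfolding charge by (intro integrable_mult_right expectation_N(1) t')
  show "expectation (\<lambda>\<omega>. charge h M (P t \<omega>) (Q t \<omega>)) =
      expectation (\<lambda>\<omega>. charge h M (P 0 \<omega>) (Q 0 \<omega>)) + 2 * C1\<^sup>2 * (norm_h h M \<eta>1)\<^sup>2 * t"
    unfolding charge \<kappa>[symmetric] by (simp add: expectation_N(2)[OF t'] algebra_simps)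
qed

theorem theorem3p1:
  fixes \<Omega> :: "'a measure" and F :: "real \<Rightarrow> 'a measure"
    and B :: "nat \<Rightarrow> real \<Rightarrow> 'a \<Rightarrow> real"
    and a b T C1 C2 :: real and M :: nat
    and \<phi>0 :: "real \<Rightarrow> complex" and u0 \<mu>0 \<eta>1 \<eta>2 :: "real \<Rightarrow> real"
    and approxP approxQ approxU approxV :: "(real \<Rightarrow> real) \<Rightarrow> nat \<Rightarrow> real"
    and P Q U V :: "real \<Rightarrow> 'a \<Rightarrow> nat \<Rightarrow> real"
  assumes "prob_space \<Omega>"
    and "filtration (space \<Omega>) F" and "\<And>t. subalgebra \<Omega> (F t)"
    and "indep_wiener_processes \<Omega> F {0, 1, 2} B"
    and "a < b" and "T > 0" and "M \<ge> 1"
    and "\<phi>0 \<in> H10_on a b" and "u0 \<in> H10_on a b" and "\<mu>0 \<in> L2_on a b"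
    and "\<eta>1 \<in> H10_on a b" and "\<eta>2 \<in> L2_on a b"
    and "semidiscrete_KGS_solution \<Omega> F T (mesh a b M) M C1 C2
           (grid_values a b M \<eta>1) (grid_values a b M \<eta>2) B
           (approxP (\<lambda>x. Re (\<phi>0 x))) (approxQ (\<lambda>x. Im (\<phi>0 x)))
           (approxU u0) (approxV (\<lambda>x. 1 / 2 * \<mu>0 x)) P Q U V"
  shows "\<forall>t\<in>{0..T}.
    integrable \<Omega> (\<lambda>\<omega>. charge (mesh a b M) M (P t \<omega>) (Q t \<omega>)) \<and>
    prob_space.expectation \<Omega> (\<lambda>\<omega>. charge (mesh a b M) M (P t \<omega>) (Q t \<omega>)) =
      prob_space.expectation \<Omega> (\<lambda>\<omega>. charge (mesh a b M) M (P 0 \<omega>) (Q 0 \<omega>))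
      + 2 * C1\<^sup>2 * (norm_h (mesh a b M) M (grid_values a b M \<eta>1))\<^sup>2 * t"
proof
  fix t assume t: "t \<in> {0..T}"
  have "mesh a b M \<ge> 0"
    using assms(5) by (simp add: mesh_def)
  note KGS = semidiscrete_KGS_expectation[OF assms(1-4,6) this assms(13) t]
  show "integrable \<Omega> (\<lambda>\<omega>. charge (mesh a b M) M (P t \<omega>) (Q t \<omega>)) \<and>
    prob_space.expectation \<Omega> (\<lambda>\<omega>. charge (mesh a b M) M (P t \<omega>) (Q t \<omega>)) =
      prob_space.expectation \<Omega> (\<lambda>\<omega>. charge (mesh a b M) M (P 0 \<omega>) (Q 0 \<omega>))
      + 2 * C1\<^sup>2 * (norm_h (mesh a b M) M (grid_values a b M \<eta>1))\<^sup>2 * t"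
    by (rule conjI[OF KGS])
qed

end
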